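(* Let $A$ be an RSLR type and $t,s$ closed RSLR terms of type $A$. Then $t$ and $s$ are context equivalent if and only if they are trace equivalent.
   Context: \textbf{The calculus RSLR.} Aspects are $\square$ and $\blacksquare$, ordered by $\square<:\square$, $\square<:\blacksquare$, $\blacksquare<:\blacksquare$. Types: $A::=\mathsf{Str}\mid\mathsf aA\to A$. Subtyping: least reflexive transitive relation with $\mathsf aA\to C<:\mathsf bB\to D$ whenever $B<:A$, $C<:D$, $\mathsf a<:\mathsf b$. Terms: $t::=x\mid\underline m\mid\lambda x:\mathsf aA.t\mid\mathsf0(t)\mid\mathsf1(t)\mid\mathsf{tail}(t)\mid t\,t\mid\mathsf{case}_A(t,t_0,t_1,t_\epsilon)\mid\mathsf{rec}_A(t,t_0,t_1,t_\epsilon)\mid\mathsf{rand}$ with $m\in\{0,1\}^*$ ($\underline\epsilon$ empty string); values are string constants and abstractions. Typing contexts are finite sets of declarations $x:\mathsf aA$; $\Gamma;\Delta$ denotes disjoint union where $\Gamma$ declares only $\mathsf{Str}$ variables; $\Gamma<:\mathsf a$ means all declared aspects $\mathsf b$ satisfy $\mathsf b<:\mathsf a$. Typing rules: variables, string constants of type $\mathsf{Str}$, $\mathsf0,\mathsf1,\mathsf{tail}$ from $\mathsf{Str}$ to $\mathsf{Str}$, $\vdash\mathsf{rand}:\mathsf{Str}$, abstraction, subsumption; application: $\Gamma;\Delta_1\vdash t:\mathsf aA\to B$, $\Gamma;\Delta_2\vdash s:A$, $\Gamma,\Delta_2<:\mathsf a$ give $\Gamma;\Delta_1,\Delta_2\vdash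 ts:B$; case: $\Gamma;\Delta_1\vdash t:\mathsf{Str}$, $\Gamma;\Delta_2\vdash t_0:A$, $\Gamma;\Delta_3\vdash t_1:A$, $\Gamma;\Delta_4\vdash t_\epsilon:A$ give $\Gamma;\Delta_1,\dots,\Delta_4\vdash\mathsf{case}_A(t,t_0,t_1,t_\epsilon):A$; recursion: $\Gamma_1;\Delta_1\vdash t:\mathsf{Str}$, $\Gamma_1,\Gamma_2\vdash t_0:\square\mathsf{Str}\to\blacksquare A\to A$, $\Gamma_1,\Gamma_3\vdash t_1:\square\mathsf{Str}\to\blacksquare A\to A$, $\Gamma_1,\Gamma_2,\Gamma_3;\Delta_2\vdash t_\epsilon:A$, $\Gamma_1,\Delta_1<:\square$, $A$ $\square$-free give $\Gamma_1,\Gamma_2,\Gamma_3;\Delta_1,\Delta_2\vdash\mathsf{rec}_A(t,t_0,t_1,t_\epsilon):A$. Every closed typable $t$ has a value distribution $[\![t]\!]$ given by probabilistic call-by-value big-step semantics: values evaluate to themselves; $\mathsf{rand}$ yields $\underline0,\underline1$ with probability $1/2$ each; $\mathsf0,\mathsf1$ prepend a bit, $\mathsf{tail}$ drops the first bit ($\mathrm{tail}(\epsilon)=\epsilon$); $[\![ts]\!]=\sum[\![t]\!](\lambda x.r)[\![s]\!](v)[\![r\{v/x\}]\!]$; $\mathsf{case}$ continues with $t_0$, $t_1$ or $t_\epsilon$ according to whether the evaluated string begins with $0$, with $1$, or is empty; $\mathsf{rec}_A(\underline\epsilon,\dots)$ continues as $t_\epsilon$, $\mathsf{rec}_A(\underline{bn},t_0,t_1,t_\epsilon)$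 as $(t_b\,\underline{bn})(\mathsf{rec}_A(\underline n,t_0,t_1,t_\epsilon))$. \textbf{Contexts.} Generated by $C::=t\mid[\cdot]\mid\lambda x.C\mid C\,t\mid t\,C\mid\mathsf0(C)\mid\mathsf1(C)\mid\mathsf{tail}(C)\mid\mathsf{case}_A(C,t,t,t)\mid\mathsf{case}_A(t,C,C,C)\mid\mathsf{rec}_A(C,t,t,t)$, hole occurring at most once; $C[t]$ fills the hole with the closed term $t$; $\vdash C[\vdash A]:B$ means that for every closed $t$ with $\vdash t:A$, $\vdash C[t]:B$. Closed $t,s$ of type $A$ are context equivalent if $[\![C[t]]\!](\underline\epsilon)=[\![C[s]]\!](\underline\epsilon)$ for every context $C$ with $\vdash C[\vdash A]:\mathsf{Str}$. \textbf{Traces.} Actions: $\mathsf{pass}(v)$ ($v$ closed value), $\mathsf{view}(\underline m)$. Traces compatible with $\mathsf{Str}$: $\mathsf{view}(\underline m)$; with $\mathsf bB\to C$: $\mathsf{pass}(v)\cdot S$, $\vdash v:B$, $S$ compatible with $C$. For $t$ closed of type $\mathsf a_1A_1\to\cdots\to\mathsf a_kA_k\to\mathsf{Str}$ and $T=\mathsf{pass}(v_1)\cdots\mathsf{pass}(v_k)\mathsf{view}(\underline m)$: $\mathcal D_0=[\![t]\!]$, $\mathcal D_i=\sum_{\lambda x.r}\mathcal D_{i-1}(\lambda x.r)[\![r\{v_i/x\}]\!]$, $\Pr(t,T)=\mathcal D_k(\underline m)$. $t,s$ are trace equivalent if $\Pr(t,T)=\Pr(s,T)$ for all compatible $T$.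 *)

theory Defs
  imports "HOL-Probability.SPMF"
begin

section \<open>Types and terms\<close>

datatype aspect = WBox | BBox  \<comment> \<open>white box and black box\<close>

fun aspect_le :: "aspect \<Rightarrow> aspect \<Rightarrow> bool" where
  "aspect_le WBox b = True"
| "aspect_le BBox b = (b = BBox)"

datatype ty = Str | Fun aspect ty ty

inductive subty :: "ty \<Rightarrow> ty \<Rightarrow> bool" where
  refl: "subty A A"
| trans: "subty A B \<Longrightarrow> subty B C \<Longrightarrow> subty A C"
| fn: "subty B A \<Longrightarrow> subty C D \<Longrightarrow> aspect_le a b \<Longrightarrow> subty (Fun a A C) (Fun b B D)"

primrec box_free :: "ty \<Rightarrow> bool" where
  "box_free Str = True"
| "box_free (Fun a A B) = (a \<noteq> WBox \<and> box_free A \<and> box_free B)"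

text \<open>Terms are taken up to renaming of bound variables, by means of de Bruijn indices.
  In bit strings, \<open>False\<close> is the bit 0 and \<open>True\<close> is the bit 1.\<close>

datatype tm =
    Var nat
  | SConst "bool list"
  | Lam aspect ty tm
  | Zero tm
  | One tm
  | Tail tm
  | App tm tm
  | Case ty tm tm tm tm
  | Rec ty tm tm tm tm
  | Rand

inductive is_value :: "tm \<Rightarrow> bool" where
  "is_value (SConst m)"
| "is_value (Lam a A t)"

text \<open>Substitution of \<open>v\<close> for the variable with index \<open>k\<close>. It is only used with
  closed \<open>v\<close>, so \<open>v\<close> is not shifted under binders.\<close>

primrec subst :: "nat \<Rightarrow> tm \<Rightarrow> tm \<Rightarrow> tm" where
  "subst k v (Var n) = (if n < k then Var n else if n = k then v else Var (n - 1))"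
| "subst k v (SConst m) = SConst m"
| "subst k v (Lam a A t) = Lam a A (subst (Suc k) v t)"
| "subst k v (Zero t) = Zero (subst k v t)"
| "subst k v (One t) = One (subst k v t)"
| "subst k v (Tail t) = Tail (subst k v t)"
| "subst k v (App t s) = App (subst k v t) (subst k v s)"
| "subst k v (Case A t t0 t1 te) =
     Case A (subst k v t) (subst k v t0) (subst k v t1) (subst k v te)"
| "subst k v (Rec A t t0 t1 te) =
     Rec A (subst k v t) (subst k v t0) (subst k v t1) (subst k v te)"
| "subst k v Rand = Rand"


section \<open>Typing\<close>

type_synonym tctx = "nat \<rightharpoonup> aspect \<times> ty"

definition str_ctx :: "tctx \<Rightarrow> bool" where
  "str_ctx \<Gamma> \<longleftrightarrow> (\<forall>a A. (a, A) \<in> ran \<Gamma> \<longrightarrow> A = Str)"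

definition ctx_le :: "tctx \<Rightarrow> aspect \<Rightarrow> bool" where
  "ctx_le \<Gamma> a \<longleftrightarrow> (\<forall>b B. (b, B) \<in> ran \<Gamma> \<longrightarrow> aspect_le b a)"

definition disjoint_ctxs :: "tctx list \<Rightarrow> bool" where
  "disjoint_ctxs = sorted_wrt (\<lambda>\<Gamma> \<Delta>. dom \<Gamma> \<inter> dom \<Delta> = {})"

definition bind_var :: "aspect \<Rightarrow> ty \<Rightarrow> tctx \<Rightarrow> tctx" where
  "bind_var a A \<Gamma> = (\<lambda>n. case n of 0 \<Rightarrow> Some (a, A) | Suc k \<Rightarrow> \<Gamma> k)"

text \<open>The axioms accept unused declarations: the system is affine.\<close>

inductive typing :: "tctx \<Rightarrow> tm \<Rightarrow> ty \<Rightarrow> bool" where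
  T_Var: "finite (dom \<Gamma>) \<Longrightarrow> \<Gamma> n = Some (a, A) \<Longrightarrow> typing \<Gamma> (Var n) A"
| T_SConst: "finite (dom \<Gamma>) \<Longrightarrow> typing \<Gamma> (SConst m) Str"
| T_Rand: "finite (dom \<Gamma>) \<Longrightarrow> typing \<Gamma> Rand Str"
| T_Zero: "typing \<Gamma> t Str \<Longrightarrow> typing \<Gamma> (Zero t) Str"
| T_One: "typing \<Gamma> t Str \<Longrightarrow> typing \<Gamma> (One t) Str"
| T_Tail: "typing \<Gamma> t Str \<Longrightarrow> typing \<Gamma> (Tail t) Str"
| T_Lam: "typing (bind_var a A \<Gamma>) t B \<Longrightarrow> typing \<Gamma> (Lam a A t) (Fun a A B)"
| T_Sub: "typing \<Gamma> t A \<Longrightarrow> subty A B \<Longrightarrow> typing \<Gamma> t B"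
| T_App: "\<lbrakk>disjoint_ctxs [\<Gamma>, \<Delta>1, \<Delta>2]; str_ctx \<Gamma>;
    typing (\<Gamma> ++ \<Delta>1) t (Fun a A B);
    typing (\<Gamma> ++ \<Delta>2) s A;
    ctx_le (\<Gamma> ++ \<Delta>2) a\<rbrakk>
    \<Longrightarrow> typing (\<Gamma> ++ \<Delta>1 ++ \<Delta>2) (App t s) B"
| T_Case: "\<lbrakk>disjoint_ctxs [\<Gamma>, \<Delta>1, \<Delta>2, \<Delta>3, \<Delta>4]; str_ctx \<Gamma>;
    typing (\<Gamma> ++ \<Delta>1) t Str;
    typing (\<Gamma> ++ \<Delta>2) t0 A;
    typing (\<Gamma> ++ \<Delta>3) t1 A;
    typing (\<Gamma> ++ \<Delta>4) te A\<rbrakk>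
    \<Longrightarrow> typing (\<Gamma> ++ \<Delta>1 ++ \<Delta>2 ++ \<Delta>3 ++ \<Delta>4) (Case A t t0 t1 te) A"
| T_Rec: "\<lbrakk>disjoint_ctxs [\<Gamma>1, \<Gamma>2, \<Gamma>3, \<Delta>1, \<Delta>2];
    str_ctx \<Gamma>1; str_ctx \<Gamma>2; str_ctx \<Gamma>3;
    typing (\<Gamma>1 ++ \<Delta>1) t Str;
    typing (\<Gamma>1 ++ \<Gamma>2) t0 (Fun WBox Str (Fun BBox A A));
    typing (\<Gamma>1 ++ \<Gamma>3) t1 (Fun WBox Str (Fun BBox A A));
    typing (\<Gamma>1 ++ \<Gamma>2 ++ \<Gamma>3 ++ \<Delta>2) te A;
    ctx_le (\<Gamma>1 ++ \<Delta>1) WBox; box_free A\<rbrakk>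
    \<Longrightarrow> typing (\<Gamma>1 ++ \<Gamma>2 ++ \<Gamma>3 ++ \<Delta>1 ++ \<Delta>2) (Rec A t t0 t1 te) A"

abbreviation closed_typing :: "tm \<Rightarrow> ty \<Rightarrow> bool" where
  "closed_typing \<equiv> typing Map.empty"


section \<open>Probabilistic call-by-value big-step semantics\<close>

fun case_cont :: "tm \<Rightarrow> tm \<Rightarrow> tm \<Rightarrow> bool list \<Rightarrow> tm" where
  "case_cont t0 t1 te [] = te"
| "case_cont t0 t1 te (b # n) = (if b then t1 else t0)"

fun rec_cont :: "ty \<Rightarrow> tm \<Rightarrow> tm \<Rightarrow> tm \<Rightarrow> bool list \<Rightarrow> tm" where
  "rec_cont A t0 t1 te [] = te"
| "rec_cont A t0 t1 te (b # n) =
     App (App (if b then t1 else t0) (SConst (b # n))) (Rec A (SConst n) t0 t1 te)"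

text \<open>In \<open>E_App\<close>, \<open>D\<close> is the distribution of abstractions produced by \<open>t\<close>; in the rules
  below it, \<open>D\<close> is a distribution on bit strings. A term that gets stuck with positive
  probability is therefore related to no distribution.\<close>

inductive eval :: "tm \<Rightarrow> tm pmf \<Rightarrow> bool" where
  E_Val: "is_value v \<Longrightarrow> eval v (return_pmf v)"
| E_Rand: "eval Rand (map_pmf (\<lambda>b. SConst [b]) (bernoulli_pmf (1/2)))"
| E_App: "\<lbrakk>eval t (map_pmf (\<lambda>(a, A, r). Lam a A r) D); eval s E;
    \<And>a A r v. (a, A, r) \<in> set_pmf D \<Longrightarrow> v \<in> set_pmf E \<Longrightarrow> eval (subst 0 v r) (F r v)\<rbrakk>
    \<Longrightarrow> eval (App t s) (bind_pmf D (\<lambda>(a, A, r). bind_pmf E (\<lambda>v. F r v)))"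
| E_Zero: "eval t (map_pmf SConst D) \<Longrightarrow> eval (Zero t) (map_pmf (\<lambda>m. SConst (False # m)) D)"
| E_One: "eval t (map_pmf SConst D) \<Longrightarrow> eval (One t) (map_pmf (\<lambda>m. SConst (True # m)) D)"
| E_Tail: "eval t (map_pmf SConst D) \<Longrightarrow> eval (Tail t) (map_pmf (\<lambda>m. SConst (tl m)) D)"
| E_Case: "\<lbrakk>eval t (map_pmf SConst D);
    \<And>m. m \<in> set_pmf D \<Longrightarrow> eval (case_cont t0 t1 te m) (F m)\<rbrakk>
    \<Longrightarrow> eval (Case A t t0 t1 te) (bind_pmf D F)"
| E_Rec: "\<lbrakk>eval t (map_pmf SConst D);
    \<And>m. m \<in> set_pmf D \<Longrightarrow> eval (rec_cont A t0 t1 te m) (F m)\<rbrakk>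
    \<Longrightarrow> eval (Rec A t t0 t1 te) (bind_pmf D F)"

text \<open>The value distribution of a term. It is meaningful for closed typable terms, for which
  \<open>eval\<close> determines exactly one distribution; uniqueness holds for all terms.\<close>

definition sem :: "tm \<Rightarrow> tm pmf" where
  "sem t = (THE D. eval t D)"

inductive_cases eval_RandE: "eval Rand D"
inductive_cases eval_AppE: "eval (App t s) D"
inductive_cases eval_ZeroE: "eval (Zero t) D"
inductive_cases eval_OneE: "eval (One t) D"
inductive_cases eval_TailE: "eval (Tail t) D"
inductive_cases eval_CaseE: "eval (Case A t t0 t1 te) D"
inductive_cases eval_RecE: "eval (Rec A t t0 t1 te) D"
inductive_cases eval_SConstE: "eval (SConst m) D"
inductive_cases eval_LamE: "eval (Lam a A t) D"

lemma map_pmf_SConst_inject: "map_pmf SConst D = map_pmf SConst D' \<longleftrightarrow> D = D'"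
  by (rule inj_eq[OF pmf.inj_map]) (simp add: inj_on_def)

lemma map_pmf_Lam_inject:
  "map_pmf (\<lambda>(a, A, r). Lam a A r) D = map_pmf (\<lambda>(a, A, r). Lam a A r) D' \<longleftrightarrow> D = D'"
  by (rule inj_eq[OF pmf.inj_map]) (auto simp: inj_on_def)

theorem eval_unique: "eval t D \<Longrightarrow> eval t D' \<Longrightarrow> D = D'"
proof (induction t D arbitrary: D' rule: eval.induct)
  case (E_Val v)
  then show ?case
    by (auto elim!: is_value.cases eval_SConstE eval_LamE)
next
  case E_Rand
  then show ?case
    by (auto elim!: eval_RandE is_value.cases)
next
  case (E_App t D s E F)
  from E_App.prems show ?case
  proof (rule eval_AppE)
    assume "is_value (App t s)"
    then show ?thesis by (auto elim: is_value.cases)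
  next
    fix D2 E2 F2
    assume D': "D' = bind_pmf D2 (\<lambda>(a, A, r). bind_pmf E2 (F2 r))"
      and t: "eval t (map_pmf (\<lambda>(a, A, r). Lam a A r) D2)" and s: "eval s E2"
      and F2: "\<And>a A r v. (a, A, r) \<in> set_pmf D2 \<Longrightarrow> v \<in> set_pmf E2 \<Longrightarrow>
        eval (subst 0 v r) (F2 r v)"
    have "D = D2" using E_App.IH(1)[OF t] by (simp add: map_pmf_Lam_inject)
    moreover have "E = E2" using E_App.IH(2)[OF s] .
    ultimately show ?thesis
      unfolding D' using E_App.IH(3) F2 by (auto intro!: bind_pmf_cong)
  qed
next
  case (E_Zero t D)
  then show ?case
    by (metis eval_ZeroE is_value.cases map_pmf_SConst_inject tm.distinct)
next
  case (E_One t D)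
  then show ?case
    by (metis eval_OneE is_value.cases map_pmf_SConst_inject tm.distinct)
next
  case (E_Tail t D)
  then show ?case
    by (metis eval_TailE is_value.cases map_pmf_SConst_inject tm.distinct)
next
  case (E_Case t D t0 t1 te F A)
  from E_Case.prems show ?case
    by (rule eval_CaseE)
      (auto elim: is_value.cases dest!: E_Case.IH(1) simp: map_pmf_SConst_inject
        intro!: bind_pmf_cong E_Case.IH(2))
next
  case (E_Rec t D A t0 t1 te F)
  from E_Rec.prems show ?case
    by (rule eval_RecE)
      (auto elim: is_value.cases dest!: E_Rec.IH(1) simp: map_pmf_SConst_inject
        intro!: bind_pmf_cong E_Rec.IH(2))
qed

corollary sem_eqI: "eval t D \<Longrightarrow> sem t = D"
  unfolding sem_def by (blast intro: eval_unique)


section \<open>Context equivalence\<close>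

datatype cx =
    CTerm tm
  | Hole
  | CLam aspect ty cx
  | CAppL cx tm
  | CAppR tm cx
  | CZero cx
  | COne cx
  | CTail cx
  | CCaseScrut ty cx tm tm tm
  | CCaseBranch ty tm cx cx cx
  | CRec ty cx tm tm tm

primrec holes :: "cx \<Rightarrow> nat" where
  "holes (CTerm t) = 0"
| "holes Hole = 1"
| "holes (CLam a A C) = holes C"
| "holes (CAppL C t) = holes C"
| "holes (CAppR t C) = holes C"
| "holes (CZero C) = holes C"
| "holes (COne C) = holes C"
| "holes (CTail C) = holes C"
| "holes (CCaseScrut A C t0 t1 te) = holes C"
| "holes (CCaseBranch A t C0 C1 Ce) = holes C0 + holes C1 + holes Ce"
| "holes (CRec A C t0 t1 te) = holes C"

text \<open>The hole is only ever filled with a closed term, so nothing is shifted under binders.\<close>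

primrec fill :: "cx \<Rightarrow> tm \<Rightarrow> tm" where
  "fill (CTerm t) s = t"
| "fill Hole s = s"
| "fill (CLam a A C) s = Lam a A (fill C s)"
| "fill (CAppL C t) s = App (fill C s) t"
| "fill (CAppR t C) s = App t (fill C s)"
| "fill (CZero C) s = Zero (fill C s)"
| "fill (COne C) s = One (fill C s)"
| "fill (CTail C) s = Tail (fill C s)"
| "fill (CCaseScrut A C t0 t1 te) s = Case A (fill C s) t0 t1 te"
| "fill (CCaseBranch A t C0 C1 Ce) s = Case A t (fill C0 s) (fill C1 s) (fill Ce s)"
| "fill (CRec A C t0 t1 te) s = Rec A (fill C s) t0 t1 te"

definition cx_typing :: "cx \<Rightarrow> ty \<Rightarrow> ty \<Rightarrow> bool" where
  "cx_typing C A B \<longleftrightarrow> (\<forall>t. closed_typing t A \<longrightarrow> closed_typing (fill C t) B)"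

definition context_equiv :: "ty \<Rightarrow> tm \<Rightarrow> tm \<Rightarrow> bool" where
  "context_equiv A t s \<longleftrightarrow>
     (\<forall>C. holes C \<le> 1 \<and> cx_typing C A Str \<longrightarrow>
        pmf (sem (fill C t)) (SConst []) = pmf (sem (fill C s)) (SConst []))"


section \<open>Trace equivalence\<close>

datatype act = Pass tm | View "bool list"

inductive compatible :: "ty \<Rightarrow> act list \<Rightarrow> bool" where
  "compatible Str [View m]"
| "is_value v \<Longrightarrow> closed_typing v B \<Longrightarrow> compatible C S \<Longrightarrow> compatible (Fun b B C) (Pass v # S)"

text \<open>Only abstractions contribute to the outcome of passing an argument.\<close>

definition pass_arg :: "tm spmf \<Rightarrow> tm \<Rightarrow> tm spmf" where
  "pass_arg D v = bind_spmf D (\<lambda>f. case f of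
      Lam a A r \<Rightarrow> spmf_of_pmf (sem (subst 0 v r))
    | _ \<Rightarrow> return_pmf None)"

text \<open>The last equation covers action lists that are not of the form
  \<open>pass(v1) ... pass(vk) view(m)\<close>; these are compatible with no type.\<close>

fun trace_pr_from :: "tm spmf \<Rightarrow> act list \<Rightarrow> real" where
  "trace_pr_from D [View m] = spmf D (SConst m)"
| "trace_pr_from D (Pass v # S) = trace_pr_from (pass_arg D v) S"
| "trace_pr_from D _ = 0"

definition trace_pr :: "tm \<Rightarrow> act list \<Rightarrow> real" where
  "trace_pr t T = trace_pr_from (spmf_of_pmf (sem t)) T"

definition trace_equiv :: "ty \<Rightarrow> tm \<Rightarrow> tm \<Rightarrow> bool" where
  "trace_equiv A t s \<longleftrightarrow> (\<forall>T. compatible A T \<longrightarrow> trace_pr t T = trace_pr s T)"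

end

(* Each type carries a reducibility predicate on values and a relation on value
   distributions; the relation is trace equivalence with reducible arguments. A variable of
   function type is evaluated at most once, so a typed term, seen as a function of such a
   variable, acts linearly on distributions of values, and a rule induction shows that it maps
   trace equivalent distributions to trace equivalent ones; for string variables, which may be
   copied, trace equivalence is equality. Building this preservation into reducibility makes
   the induction go through under binders and also yields termination. Along the derivation of
   a filled context, trace equivalence of the fillings then propagates to the whole context.
   Conversely, a trace is realised by the context that applies the hole to the passed values
   and compares the result with the viewed string. *)

theory Submission
  imports Defs
begin

section \<open>Typing and substitution\<close>

text \<open>The obstacle is that trace equivalence lives on distributions and has no counterpart on
  single values. The even mixture of the constant functions returning \<open>[False]\<close> and
  \<open>[True]\<close> has the same traces as the one abstraction whose body is
  \<open>Rand\<close>, yet neither value of the mixture is equivalent to that abstraction. A logical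
  relation between values would separate the two, and so would a context that runs the function
  twice. Hence a function is asked to respect whole mixtures of arguments, each drawn once per run,
  and the typing rules must exclude the second use. What makes each construct compatible with this
  reading is Fubini: the draw of the unknown value and an unrelated evaluation are independent, so
  they may be swapped, the unrelated result may be fixed, and the hypothesis applies to the
  remaining mixture. \<open>tr_eq\<close> tests functions with reducible values rather than with all
  closed typable ones because evaluation of an application is only known to succeed for reducible
  parts until the fundamental lemma is available.\<close>

lemma typing_finite_dom:
  "typing \<Gamma> t A \<Longrightarrow> finite (dom \<Gamma>)"
proof (induction rule: typing.induct)
  case (T_Lam a A \<Gamma> t B)
  have "Suc ` dom \<Gamma> \<subseteq> dom (bind_var a A \<Gamma>)"
    by (auto simp: bind_var_def)
  then have "finite (Suc ` dom \<Gamma>)"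
    using T_Lam.IH finite_subset by blast
  then show ?case
    by (simp add: finite_image_iff)
qed auto

section \<open>Splitting, restricting and enlarging typing contexts\<close>

lemma disjoint_ctxs_restrict:
  "disjoint_ctxs \<Gamma>s \<Longrightarrow> disjoint_ctxs (map (\<lambda>\<Gamma>. \<Gamma> |` K) \<Gamma>s)"
  unfolding disjoint_ctxs_def sorted_wrt_map
  by (erule sorted_wrt_mono_rel[rotated]) auto

lemma map_add_restrict: "(\<Gamma> ++ \<Delta>) |` K = \<Gamma> |` K ++ \<Delta> |` K"
  by (auto simp: restrict_map_def map_add_def fun_eq_iff)

lemma ran_restrict_subset: "ran (\<Gamma> |` K) \<subseteq> ran \<Gamma>"
  by (auto simp: ran_def restrict_map_def split: if_splits)

lemma str_ctx_restrict: "str_ctx \<Gamma> \<Longrightarrow> str_ctx (\<Gamma> |` K)"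
  using ran_restrict_subset[of \<Gamma> K] by (auto simp: str_ctx_def)

lemma ctx_le_restrict: "ctx_le \<Gamma> a \<Longrightarrow> ctx_le (\<Gamma> |` K) a"
  using ran_restrict_subset[of \<Gamma> K] by (auto simp: ctx_le_def)

lemma bind_var_restrict:
  "bind_var a A \<Gamma> |` {..<Suc k} = bind_var a A (\<Gamma> |` {..<k})"
  by (auto simp: bind_var_def restrict_map_def fun_eq_iff split: nat.splits)

lemma bind_var_simps [simp]:
  "bind_var a A \<Gamma> 0 = Some (a, A)" "bind_var a A \<Gamma> (Suc n) = \<Gamma> n"
  by (simp_all add: bind_var_def)

lemma map_le_iff: "\<Gamma> \<subseteq>\<^sub>m \<Delta> \<longleftrightarrow> (\<forall>n x. \<Gamma> n = Some x \<longrightarrow> \<Delta> n = Some x)"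
  by (force simp: map_le_def dom_def)

lemma map_add_disjoint_Some_iff:
  "dom \<Gamma> \<inter> dom \<Delta> = {} \<Longrightarrow> (\<Gamma> ++ \<Delta>) n = Some x \<longleftrightarrow> \<Gamma> n = Some x \<or> \<Delta> n = Some x"
  by (auto simp: map_add_Some_iff domIff disjoint_iff)

lemma map_le_App:
  assumes "disjoint_ctxs [\<Gamma>, \<Delta>1, \<Delta>2]"
  shows "\<Gamma> ++ \<Delta>1 \<subseteq>\<^sub>m \<Gamma> ++ \<Delta>1 ++ \<Delta>2" "\<Gamma> ++ \<Delta>2 \<subseteq>\<^sub>m \<Gamma> ++ \<Delta>1 ++ \<Delta>2"
  using assms
  by (simp_all add: disjoint_ctxs_def map_le_iff map_add_disjoint_Some_iff Int_Un_distrib2)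

lemma map_le_Case:
  assumes "disjoint_ctxs [\<Gamma>, \<Delta>1, \<Delta>2, \<Delta>3, \<Delta>4]"
  shows "\<Gamma> ++ \<Delta>1 \<subseteq>\<^sub>m \<Gamma> ++ \<Delta>1 ++ \<Delta>2 ++ \<Delta>3 ++ \<Delta>4"
    and "\<Gamma> ++ \<Delta>2 \<subseteq>\<^sub>m \<Gamma> ++ \<Delta>1 ++ \<Delta>2 ++ \<Delta>3 ++ \<Delta>4"
    and "\<Gamma> ++ \<Delta>3 \<subseteq>\<^sub>m \<Gamma> ++ \<Delta>1 ++ \<Delta>2 ++ \<Delta>3 ++ \<Delta>4"
    and "\<Gamma> ++ \<Delta>4 \<subseteq>\<^sub>m \<Gamma> ++ \<Delta>1 ++ \<Delta>2 ++ \<Delta>3 ++ \<Delta>4"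
  using assms
  by (simp_all add: disjoint_ctxs_def map_le_iff map_add_disjoint_Some_iff Int_Un_distrib2)

lemma map_le_Rec:
  assumes "disjoint_ctxs [\<Gamma>1, \<Gamma>2, \<Gamma>3, \<Delta>1, \<Delta>2]"
  shows "\<Gamma>1 ++ \<Delta>1 \<subseteq>\<^sub>m \<Gamma>1 ++ \<Gamma>2 ++ \<Gamma>3 ++ \<Delta>1 ++ \<Delta>2"
    and "\<Gamma>1 ++ \<Gamma>2 \<subseteq>\<^sub>m \<Gamma>1 ++ \<Gamma>2 ++ \<Gamma>3 ++ \<Delta>1 ++ \<Delta>2"
    and "\<Gamma>1 ++ \<Gamma>3 \<subseteq>\<^sub>m \<Gamma>1 ++ \<Gamma>2 ++ \<Gamma>3 ++ \<Delta>1 ++ \<Delta>2"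
    and "\<Gamma>1 ++ \<Gamma>2 ++ \<Gamma>3 ++ \<Delta>2 \<subseteq>\<^sub>m \<Gamma>1 ++ \<Gamma>2 ++ \<Gamma>3 ++ \<Delta>1 ++ \<Delta>2"
  using assms
  by (simp_all add: disjoint_ctxs_def map_le_iff map_add_disjoint_Some_iff Int_Un_distrib2)

lemma map_le_SomeD: "\<Gamma> \<subseteq>\<^sub>m \<Delta> \<Longrightarrow> \<Gamma> n = Some x \<Longrightarrow> \<Delta> n = Some x"
  by (simp add: map_le_iff)

lemma bind_var_map_le: "\<Gamma> \<subseteq>\<^sub>m \<Delta> \<Longrightarrow> bind_var a A \<Gamma> \<subseteq>\<^sub>m bind_var a A \<Delta>"
  by (auto simp: map_le_iff bind_var_def split: nat.splits)

lemma finite_dom_bind_var: "finite (dom \<Gamma>) \<Longrightarrow> finite (dom (bind_var a A \<Gamma>))"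
proof -
  assume "finite (dom \<Gamma>)"
  moreover have "dom (bind_var a A \<Gamma>) \<subseteq> insert 0 (Suc ` dom \<Gamma>)"
  proof
    fix n assume "n \<in> dom (bind_var a A \<Gamma>)"
    then show "n \<in> insert 0 (Suc ` dom \<Gamma>)"
      by (cases n) auto
  qed
  ultimately show ?thesis
    using finite_subset by blast
qed

text \<open>Serves weakening: \<open>X\<close> collects everything outside
  \<open>dom \<Theta>\<close>, so all new declarations land in the replacement of
  \<open>\<Delta>\<close> while \<open>\<Theta>\<close>, with its side conditions, stays as it
  is.\<close>

lemma map_le_extend:
  assumes "\<Theta> ++ \<Delta> \<subseteq>\<^sub>m \<Gamma>" "dom \<Theta> \<inter> dom \<Delta> = {}"
  obtains X where "\<Gamma> = \<Theta> ++ X" "\<Delta> \<subseteq>\<^sub>m X" "dom X \<inter> dom \<Theta> = {}"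
proof
  have le: "\<Theta> \<subseteq>\<^sub>m \<Gamma>" "\<Delta> \<subseteq>\<^sub>m \<Gamma>"
    using assms by (simp_all add: map_le_iff map_add_disjoint_Some_iff)
  show "\<Gamma> = \<Theta> ++ \<Gamma> |` (- dom \<Theta>)"
    using le(1) by (auto simp: fun_eq_iff map_add_def restrict_map_def map_le_def domIff split: option.splits)
  show "\<Delta> \<subseteq>\<^sub>m \<Gamma> |` (- dom \<Theta>)"
    using le(2) assms(2) by (auto simp: map_le_def restrict_map_def disjoint_iff)
qed auto

text \<open>The extra declarations are always given to a context on which no rule
  imposes a condition.\<close>

lemma typing_weaken:
  "typing \<Gamma> t A \<Longrightarrow> \<Gamma> \<subseteq>\<^sub>m \<Gamma>' \<Longrightarrow> finite (dom \<Gamma>') \<Longrightarrow> typing \<Gamma>' t A"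
proof (induction arbitrary: \<Gamma>' rule: typing.induct)
  case (T_Var \<Gamma> n a A)
  then show ?case
    by (auto intro: typing.T_Var dest: map_le_SomeD)
next
  case (T_Lam a A \<Gamma> t B)
  then show ?case
    by (auto intro!: typing.T_Lam T_Lam.IH bind_var_map_le finite_dom_bind_var)
next
  case (T_App \<Gamma> \<Delta>1 \<Delta>2 t a A B s)
  \<comment> \<open>The side conditions constrain \<open>\<Gamma>\<close> and
    \<open>\<Gamma> ++ \<Delta>2\<close>, so \<open>\<Delta>1\<close> is the part that may grow; it
    is moved to the end to fit \<open>map_le_extend\<close>.\<close>
  have "(\<Gamma> ++ \<Delta>2) ++ \<Delta>1 = \<Gamma> ++ \<Delta>1 ++ \<Delta>2"
    using T_App.hyps(1) map_add_comm[of \<Delta>1 \<Delta>2]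
    by (simp add: disjoint_ctxs_def flip: map_add_assoc)
  then have "(\<Gamma> ++ \<Delta>2) ++ \<Delta>1 \<subseteq>\<^sub>m \<Gamma>'" "dom (\<Gamma> ++ \<Delta>2) \<inter> dom \<Delta>1 = {}"
    using T_App.prems(1) T_App.hyps(1) by (auto simp: disjoint_ctxs_def)
  then obtain X where X: "\<Gamma>' = (\<Gamma> ++ \<Delta>2) ++ X" "\<Delta>1 \<subseteq>\<^sub>m X" "dom X \<inter> dom (\<Gamma> ++ \<Delta>2) = {}"
    by (rule map_le_extend)
  have d: "disjoint_ctxs [\<Gamma>, X, \<Delta>2]"
    using T_App.hyps(1) X(3) by (auto simp: disjoint_ctxs_def)
  have eq: "\<Gamma>' = \<Gamma> ++ X ++ \<Delta>2"
    using X d map_add_comm[of X \<Delta>2] by (simp add: disjoint_ctxs_def flip: map_add_assoc)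
  have "\<Gamma> ++ \<Delta>1 \<subseteq>\<^sub>m \<Gamma> ++ X"
    using T_App.hyps(1) X(2) d by (auto simp: map_le_iff disjoint_ctxs_def map_add_disjoint_Some_iff)
  then have "typing (\<Gamma> ++ X) t (Fun a A B)"
    using T_App.prems(2) by (intro T_App.IH(1)) (simp_all add: eq)
  then show ?case
    unfolding eq using d T_App.hyps by (blast intro: typing.T_App)
next
  case (T_Case \<Gamma> \<Delta>1 \<Delta>2 \<Delta>3 \<Delta>4 t t0 A t1 te)
  let ?\<Theta> = "\<Gamma> ++ \<Delta>2 ++ \<Delta>3 ++ \<Delta>4"
  have "?\<Theta> ++ \<Delta>1 = \<Gamma> ++ (\<Delta>2 ++ \<Delta>3 ++ \<Delta>4 ++ \<Delta>1)"
    by simp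
  also have "\<dots> = \<Gamma> ++ \<Delta>1 ++ \<Delta>2 ++ \<Delta>3 ++ \<Delta>4"
    using T_Case.hyps(1) map_add_comm[of \<Delta>1 "\<Delta>2 ++ \<Delta>3 ++ \<Delta>4"]
    by (simp add: disjoint_ctxs_def Int_Un_distrib flip: map_add_assoc)
  finally have "?\<Theta> ++ \<Delta>1 \<subseteq>\<^sub>m \<Gamma>'" "dom ?\<Theta> \<inter> dom \<Delta>1 = {}"
    using T_Case.prems(1) T_Case.hyps(1) by (auto simp: disjoint_ctxs_def)
  then obtain X where X: "\<Gamma>' = ?\<Theta> ++ X" "\<Delta>1 \<subseteq>\<^sub>m X" "dom X \<inter> dom ?\<Theta> = {}"
    by (rule map_le_extend)
  have d: "disjoint_ctxs [\<Gamma>, X, \<Delta>2, \<Delta>3, \<Delta>4]"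
    using T_Case.hyps(1) X(3) by (auto simp: disjoint_ctxs_def)
  have "\<Gamma>' = \<Gamma> ++ (\<Delta>2 ++ \<Delta>3 ++ \<Delta>4 ++ X)"
    using X by simp
  also have "\<dots> = \<Gamma> ++ X ++ \<Delta>2 ++ \<Delta>3 ++ \<Delta>4"
    using d map_add_comm[of X "\<Delta>2 ++ \<Delta>3 ++ \<Delta>4"]
    by (simp add: disjoint_ctxs_def Int_Un_distrib flip: map_add_assoc)
  finally have eq: "\<Gamma>' = \<Gamma> ++ X ++ \<Delta>2 ++ \<Delta>3 ++ \<Delta>4" .
  have "\<Gamma> ++ \<Delta>1 \<subseteq>\<^sub>m \<Gamma> ++ X"
    using T_Case.hyps(1) X(2) d by (auto simp: map_le_iff disjoint_ctxs_def map_add_disjoint_Some_iff)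
  then have "typing (\<Gamma> ++ X) t Str"
    using T_Case.prems(2) by (intro T_Case.IH(1)) (simp_all add: eq)
  then show ?case
    unfolding eq using d T_Case.hyps by (blast intro: typing.T_Case)
next
  case (T_Rec \<Gamma>1 \<Gamma>2 \<Gamma>3 \<Delta>1 \<Delta>2 t t0 A t1 te)
  let ?\<Theta> = "\<Gamma>1 ++ \<Gamma>2 ++ \<Gamma>3 ++ \<Delta>1"
  have "?\<Theta> ++ \<Delta>2 \<subseteq>\<^sub>m \<Gamma>'" "dom ?\<Theta> \<inter> dom \<Delta>2 = {}"
    using T_Rec.prems(1) T_Rec.hyps(1) by (auto simp: disjoint_ctxs_def)
  then obtain X where X: "\<Gamma>' = ?\<Theta> ++ X" "\<Delta>2 \<subseteq>\<^sub>m X" "dom X \<inter> dom ?\<Theta> = {}"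
    by (rule map_le_extend)
  have d: "disjoint_ctxs [\<Gamma>1, \<Gamma>2, \<Gamma>3, \<Delta>1, X]"
    using T_Rec.hyps(1) X(3) by (auto simp: disjoint_ctxs_def)
  have eq: "\<Gamma>' = \<Gamma>1 ++ \<Gamma>2 ++ \<Gamma>3 ++ \<Delta>1 ++ X"
    using X by simp
  have "\<Gamma>1 ++ \<Gamma>2 ++ \<Gamma>3 ++ \<Delta>2 \<subseteq>\<^sub>m \<Gamma>1 ++ \<Gamma>2 ++ \<Gamma>3 ++ X"
    using T_Rec.hyps(1) X(2) d
    by (simp add: map_le_iff disjoint_ctxs_def map_add_disjoint_Some_iff Int_Un_distrib2)
  then have "typing (\<Gamma>1 ++ \<Gamma>2 ++ \<Gamma>3 ++ X) te A"
    using T_Rec.prems(2) by (intro T_Rec.IH(4)) (simp_all add: eq)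
  then show ?case
    unfolding eq using d T_Rec.hyps by (blast intro: typing.T_Rec)
qed (auto intro: typing.intros)

text \<open>\<open>\<sigma> n\<close> replaces the variable \<open>k + n\<close>. As for \<open>subst\<close>, all \<open>\<sigma> n\<close> are closed, so that
  nothing is shifted.\<close>

primrec msub :: "nat \<Rightarrow> (nat \<Rightarrow> tm) \<Rightarrow> tm \<Rightarrow> tm" where
  "msub k \<sigma> (Var n) = (if n < k then Var n else \<sigma> (n - k))"
| "msub k \<sigma> (SConst m) = SConst m"
| "msub k \<sigma> (Lam a A t) = Lam a A (msub (Suc k) \<sigma> t)"
| "msub k \<sigma> (Zero t) = Zero (msub k \<sigma> t)"
| "msub k \<sigma> (One t) = One (msub k \<sigma> t)"
| "msub k \<sigma> (Tail t) = Tail (msub k \<sigma> t)"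
| "msub k \<sigma> (App t s) = App (msub k \<sigma> t) (msub k \<sigma> s)"
| "msub k \<sigma> (Case A t t0 t1 te) =
     Case A (msub k \<sigma> t) (msub k \<sigma> t0) (msub k \<sigma> t1) (msub k \<sigma> te)"
| "msub k \<sigma> (Rec A t t0 t1 te) =
     Rec A (msub k \<sigma> t) (msub k \<sigma> t0) (msub k \<sigma> t1) (msub k \<sigma> te)"
| "msub k \<sigma> Rand = Rand"

lemma subst_beyond_dom:
  "typing \<Gamma> t A \<Longrightarrow> dom \<Gamma> \<subseteq> {..<k} \<Longrightarrow> subst k v t = t"
proof (induction arbitrary: k rule: typing.induct)
  case (T_Lam a A \<Gamma> t B)
  have "dom (bind_var a A \<Gamma>) \<subseteq> {..<Suc k}"
    using T_Lam.prems by (force simp: bind_var_def split: nat.splits)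
  then show ?case by (simp add: T_Lam.IH)
qed auto

lemma msub_beyond_dom:
  "typing \<Gamma> t A \<Longrightarrow> dom \<Gamma> \<subseteq> {..<k} \<Longrightarrow> msub k \<sigma> t = t"
proof (induction arbitrary: k rule: typing.induct)
  case (T_Lam a A \<Gamma> t B)
  have "dom (bind_var a A \<Gamma>) \<subseteq> {..<Suc k}"
    using T_Lam.prems by (force simp: bind_var_def split: nat.splits)
  then show ?case by (simp add: T_Lam.IH)
qed auto

lemma subst_closed: "closed_typing t A \<Longrightarrow> subst k v t = t"
  by (rule subst_beyond_dom) auto

lemma msub_closed: "closed_typing t A \<Longrightarrow> msub k \<sigma> t = t"
  by (rule msub_beyond_dom) auto

lemma msub_cong:
  "typing \<Gamma> t A \<Longrightarrow> (\<forall>n. k + n \<in> dom \<Gamma> \<longrightarrow> \<sigma> n = \<tau> n) \<Longrightarrow> msub k \<sigma> t = msub k \<tau> t"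
proof (induction arbitrary: k rule: typing.induct)
  case (T_Var \<Gamma> n a A)
  then show ?case
    by (cases "n < k") (auto dest!: spec[of _ "n - k"])
next
  case (T_Lam a A \<Gamma> t B)
  then show ?case
    by (simp add: dom_def)
qed auto

abbreviation closed_env :: "(nat \<Rightarrow> tm) \<Rightarrow> bool" where
  "closed_env \<sigma> \<equiv> \<forall>n. \<exists>A. closed_typing (\<sigma> n) A"

text \<open>Closedness of the \<sigma> entries keeps the later \<open>subst\<close> from touching
  what was inserted. A beta step on a substituted abstraction thus becomes a single substitution
  into the original body, which is the form in which induction hypotheses apply.\<close>

lemma subst_msub:
  assumes "closed_env \<sigma>"
  shows "subst k w (msub (Suc k) \<sigma> t) = msub k (case_nat w \<sigma>) t"
proof (induction t arbitrary: k)
  case (Var n)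
  have "subst k w (\<sigma> m) = \<sigma> m" for m
    using assms subst_closed by blast
  then show ?case
    by (auto split: nat.splits simp: not_less less_Suc_eq) (metis Suc_diff_Suc diff_Suc_Suc diff_is_0_eq le_eq_less_or_eq not_less_eq_eq old.nat.inject order_refl)+
qed auto

text \<open>The abstraction case forces the general \<open>k\<close>, the number of binders already
  crossed; their variables are what the restricted context keeps. Restriction distributes over
  \<open>++\<close>, so every context split of the derivation survives.\<close>

lemma typing_msub:
  "typing \<Gamma> t B \<Longrightarrow> (\<And>n a A. \<Gamma> (k + n) = Some (a, A) \<Longrightarrow> closed_typing (\<sigma> n) A) \<Longrightarrow>
    typing (\<Gamma> |` {..<k}) (msub k \<sigma> t) B"
proof (induction arbitrary: k rule: typing.induct)
  case (T_Var \<Gamma> n a A)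
  show ?case
  proof (cases "n < k")
    case True
    then show ?thesis
      using T_Var.hyps by (auto intro!: typing.T_Var)
  next
    case False
    then have "closed_typing (\<sigma> (n - k)) A"
      using T_Var by (metis le_add_diff_inverse not_less)
    then have "typing (\<Gamma> |` {..<k}) (\<sigma> (n - k)) A"
      using T_Var.hyps(1) by (auto intro: typing_weaken)
    then show ?thesis
      using False by simp
  qed
next
  case (T_Lam a A \<Gamma> t B)
  then show ?case
    using T_Lam.IH[of "Suc k"] by (auto intro!: typing.T_Lam simp: bind_var_restrict)
next
  case (T_App \<Gamma> \<Delta>1 \<Delta>2 t a A B s)
  note d = disjoint_ctxs_restrict[OF T_App.hyps(1), of "{..<k}"]
  note prems = T_App.prems[OF map_le_SomeD[OF map_le_App(1)[OF T_App.hyps(1)]]]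
    T_App.prems[OF map_le_SomeD[OF map_le_App(2)[OF T_App.hyps(1)]]]
  show ?case
    unfolding msub.simps map_add_restrict
    by (rule typing.T_App[OF d[simplified list.map]])
      (use T_App.IH(1)[of k] T_App.IH(2)[of k] prems T_App.hyps(2,5) in
        \<open>auto simp: map_add_restrict[symmetric] intro: str_ctx_restrict ctx_le_restrict\<close>)
next
  case (T_Case \<Gamma> \<Delta>1 \<Delta>2 \<Delta>3 \<Delta>4 t t0 A t1 te)
  note d = disjoint_ctxs_restrict[OF T_Case.hyps(1), of "{..<k}"]
  note le = map_le_Case[OF T_Case.hyps(1), THEN map_le_SomeD]
  note prems = T_Case.prems[OF le(1)] T_Case.prems[OF le(2)] T_Case.prems[OF le(3)]
    T_Case.prems[OF le(4)]
  show ?case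
    unfolding msub.simps map_add_restrict
    by (rule typing.T_Case[OF d[simplified list.map]])
      (use T_Case.IH(1)[of k] T_Case.IH(2)[of k] T_Case.IH(3)[of k] T_Case.IH(4)[of k] prems
          T_Case.hyps(2) in
        \<open>auto simp: map_add_restrict[symmetric] intro: str_ctx_restrict\<close>)
next
  case (T_Rec \<Gamma>1 \<Gamma>2 \<Gamma>3 \<Delta>1 \<Delta>2 t t0 A t1 te)
  note d = disjoint_ctxs_restrict[OF T_Rec.hyps(1), of "{..<k}"]
  note le = map_le_Rec[OF T_Rec.hyps(1), THEN map_le_SomeD]
  note prems = T_Rec.prems[OF le(1)] T_Rec.prems[OF le(2)] T_Rec.prems[OF le(3)]
    T_Rec.prems[OF le(4)]
  show ?case
    unfolding msub.simps map_add_restrict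
    by (rule typing.T_Rec[OF d[simplified list.map]])
      (use T_Rec.IH(1)[of k] T_Rec.IH(2)[of k] T_Rec.IH(3)[of k] T_Rec.IH(4)[of k] prems
          T_Rec.hyps(2,3,4,9,10) in
        \<open>auto simp: map_add_restrict[symmetric] intro: str_ctx_restrict ctx_le_restrict\<close>)
qed (auto intro: typing.intros)

lemma closed_typing_msub:
  assumes "typing \<Gamma> t B" "\<And>n a A. \<Gamma> n = Some (a, A) \<Longrightarrow> closed_typing (\<sigma> n) A"
  shows "closed_typing (msub 0 \<sigma> t) B"
  using typing_msub[of \<Gamma> t B 0 \<sigma>] assms by (simp add: restrict_map_def)

section \<open>Reducibility and trace equality of value distributions\<close>

text \<open>\<open>tr_eq\<close> is trace equivalence of distributions of values, with the arguments ranging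
  over reducible values; the fundamental lemma identifies these with the closed typable
  values. A reducible abstraction maps trace equal argument distributions to trace equal
  result distributions: this is where linearity enters.\<close>

fun reducible :: "ty \<Rightarrow> tm \<Rightarrow> bool" and tr_eq :: "ty \<Rightarrow> tm pmf \<Rightarrow> tm pmf \<Rightarrow> bool" where
  "reducible Str v \<longleftrightarrow> (\<exists>m. v = SConst m)"
| "reducible (Fun a A B) v \<longleftrightarrow> (\<exists>b C r. v = Lam b C r) \<and> closed_typing v (Fun a A B) \<and>
     (\<forall>w. reducible A w \<longrightarrow> (\<exists>D. eval (App v w) D \<and> (\<forall>u\<in>set_pmf D. reducible B u))) \<and>
     (\<forall>E E'. (\<forall>w\<in>set_pmf E \<union> set_pmf E'. reducible A w) \<longrightarrow> tr_eq A E E' \<longrightarrow>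
        tr_eq B (bind_pmf E (\<lambda>w. sem (App v w))) (bind_pmf E' (\<lambda>w. sem (App v w))))"
| "tr_eq Str D D' \<longleftrightarrow> D = D'"
| "tr_eq (Fun a A B) D D' \<longleftrightarrow> (\<forall>w. reducible A w \<longrightarrow>
     tr_eq B (bind_pmf D (\<lambda>f. sem (App f w))) (bind_pmf D' (\<lambda>f. sem (App f w))))"

text \<open>The counterpart of \<open>reducible\<close> for terms that still have to be run. As
  \<open>eval\<close> produces a \<open>pmf\<close>, it includes evaluation to a value with total
  probability one.\<close>

definition good :: "ty \<Rightarrow> tm \<Rightarrow> bool" where
  "good A t \<longleftrightarrow> (\<exists>D. eval t D \<and> (\<forall>u\<in>set_pmf D. reducible A u))"

lemma good_eval: "good A t \<Longrightarrow> eval t (sem t)"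
  using sem_eqI by (auto simp: good_def)

lemma good_sem_reducible: "good A t \<Longrightarrow> u \<in> set_pmf (sem t) \<Longrightarrow> reducible A u"
  using sem_eqI by (auto simp: good_def)

lemma goodI: "eval t D \<Longrightarrow> (\<And>u. u \<in> set_pmf D \<Longrightarrow> reducible A u) \<Longrightarrow> good A t"
  by (auto simp: good_def)

lemma reducible_is_value: "reducible A v \<Longrightarrow> is_value v"
  by (cases A) (auto intro: is_value.intros)

lemma reducible_typed: "reducible A v \<Longrightarrow> closed_typing v A"
  by (cases A) (auto intro: typing.T_SConst)

lemma sem_value: "is_value v \<Longrightarrow> sem v = return_pmf v"
  by (intro sem_eqI E_Val)

lemma reducible_good: "reducible A v \<Longrightarrow> good A v"
  by (rule goodI[OF E_Val]) (auto simp: reducible_is_value)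

lemma reducible_app_good: "reducible (Fun a A B) f \<Longrightarrow> reducible A w \<Longrightarrow> good B (App f w)"
  by (auto simp: good_def)

lemma tr_eq_refl [simp]: "tr_eq A D D"
  by (induction A arbitrary: D) auto

text \<open>Passing an argument acts linearly on a distribution of functions, so the relation is
  closed under mixtures; at type \<open>Str\<close> this is congruence of
  \<open>bind_pmf\<close>.\<close>

lemma tr_eq_bind:
  "(\<And>i. i \<in> set_pmf I \<Longrightarrow> tr_eq A (F i) (G i)) \<Longrightarrow> tr_eq A (bind_pmf I F) (bind_pmf I G)"
proof (induction A arbitrary: F G)
  case Str
  then show ?case by (auto intro: bind_pmf_cong)
next
  case (Fun a A B)
  then show ?case by (simp add: bind_assoc_pmf)
qed

text \<open>The two inclusions need each other: at a function type, \<open>tr_eq\<close> quantifies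
  over reducible arguments and \<open>reducible\<close> contains a clause about \<open>tr_eq\<close>
  in domain and codomain.\<close>

lemma subty_reducible_tr_eq:
  "subty A B \<Longrightarrow> (\<forall>v. reducible A v \<longrightarrow> reducible B v) \<and> (\<forall>D D'. tr_eq A D D' \<longrightarrow> tr_eq B D D')"
proof (induction rule: subty.induct)
  case (fn B A C D a b)
  then have sub: "subty (Fun a A C) (Fun b B D)"
    by (blast intro: subty.fn)
  show ?case
  proof (intro conjI allI impI)
    fix v assume v: "reducible (Fun a A C) v"
    show "reducible (Fun b B D) v"
      using v fn.IH T_Sub[OF _ sub] by simp meson
  qed (use fn.IH in simp)
qed auto

lemma subty_reducible: "subty A B \<Longrightarrow> reducible A v \<Longrightarrow> reducible B v"
  and subty_tr_eq: "subty A B \<Longrightarrow> tr_eq A D D' \<Longrightarrow> tr_eq B D D'"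
  using subty_reducible_tr_eq by blast+

lemma subty_good: "subty A B \<Longrightarrow> good A t \<Longrightarrow> good B t"
  by (auto simp: good_def intro: subty_reducible)

text \<open>Being an equivalence, it gives \<open>sem_beta\<close> without any assumption that the
  terms evaluate, since both sides of \<open>sem\<close> then choose by the same predicate.\<close>

lemma eval_beta:
  assumes "is_value w"
  shows "eval (App (Lam a A r) w) D \<longleftrightarrow> eval (subst 0 w r) D"
proof
  assume "eval (subst 0 w r) D"
  then show "eval (App (Lam a A r) w) D"
    using E_App[of "Lam a A r" "return_pmf (a, A, r)" w "return_pmf w" "\<lambda>_ _. D"] assms
    by (simp add: bind_return_pmf E_Val is_value.intros)
next
  assume "eval (App (Lam a A r) w) D"
  then show "eval (subst 0 w r) D"
  proof (rule eval_AppE)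
    fix D2 E2 F2
    assume D: "D = bind_pmf D2 (\<lambda>(a, A, r). bind_pmf E2 (F2 r))"
      and t: "eval (Lam a A r) (map_pmf (\<lambda>(a, A, r). Lam a A r) D2)" and s: "eval w E2"
      and F2: "\<And>a A r v. (a, A, r) \<in> set_pmf D2 \<Longrightarrow> v \<in> set_pmf E2 \<Longrightarrow> eval (subst 0 v r) (F2 r v)"
    have "map_pmf (\<lambda>(a, A, r). Lam a A r) D2 = map_pmf (\<lambda>(a, A, r). Lam a A r) (return_pmf (a, A, r))"
      using eval_unique[OF t E_Val] by (simp add: is_value.intros)
    then have "D2 = return_pmf (a, A, r)"
      by (simp only: map_pmf_Lam_inject)
    moreover have "E2 = return_pmf w"
      using eval_unique[OF s E_Val] assms by simp
    ultimately show ?thesis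
      using F2 D by (simp add: bind_return_pmf)
  qed (auto elim: is_value.cases)
qed

lemma sem_beta: "is_value w \<Longrightarrow> sem (App (Lam a A r) w) = sem (subst 0 w r)"
  by (simp add: sem_def eval_beta)

lemma good_beta: "is_value w \<Longrightarrow> good B (App (Lam a A r) w) \<longleftrightarrow> good B (subst 0 w r)"
  by (simp add: good_def eval_beta)

lemma eval_App:
  assumes t: "good (Fun a A B) t" and s: "good A s"
  shows "eval (App t s) (bind_pmf (sem t) (\<lambda>f. bind_pmf (sem s) (\<lambda>w. sem (App f w))))"
proof -
  let ?lam = "\<lambda>(a, A, r). Lam a A r"
  \<comment> \<open>\<open>E_App\<close> expects a distribution on the components of abstractions.
    The partial \<open>case\<close> is harmless because \<open>sem t\<close> is supported on
    abstractions.\<close>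
  define D where "D = map_pmf (\<lambda>f. case f of Lam a A r \<Rightarrow> (a, A, r)) (sem t)"
  have lam: "\<exists>b C r. f = Lam b C r" if "f \<in> set_pmf (sem t)" for f
    using good_sem_reducible[OF t that] by simp
  have "map_pmf ?lam D = map_pmf id (sem t)"
    unfolding D_def map_pmf_comp
    by (rule map_pmf_cong) (auto dest!: lam)
  then have D: "sem t = map_pmf ?lam D"
    by simp
  have val: "is_value w" if "w \<in> set_pmf (sem s)" for w
    using that good_sem_reducible[OF s] reducible_is_value by blast
  have "eval (App t s) (bind_pmf D (\<lambda>(a, A, r). bind_pmf (sem s) (\<lambda>w. sem (subst 0 w r))))"
  proof (rule E_App)
    show "eval t (map_pmf ?lam D)"
      using good_eval[OF t] by (simp only: D)
    show "eval s (sem s)"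
      by (rule good_eval[OF s])
    fix b C r w assume r: "(b, C, r) \<in> set_pmf D" and w: "w \<in> set_pmf (sem s)"
    have "Lam b C r \<in> set_pmf (sem t)"
      using r by (force simp: D)
    then have "good B (App (Lam b C r) w)"
      using t s w by (blast intro: reducible_app_good good_sem_reducible)
    then show "eval (subst 0 w r) (sem (subst 0 w r))"
      using good_beta[OF val[OF w]] good_eval by blast
  qed
  also have "bind_pmf D (\<lambda>(a, A, r). bind_pmf (sem s) (\<lambda>w. sem (subst 0 w r))) =
      bind_pmf (sem t) (\<lambda>f. bind_pmf (sem s) (\<lambda>w. sem (App f w)))"
    unfolding D bind_map_pmf
    by (intro bind_pmf_cong HOL.refl) (auto simp: sem_beta val intro!: bind_pmf_cong)
  finally show ?thesis .
qed

lemmas sem_App = sem_eqI[OF eval_App]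

lemma good_App: "good (Fun a A B) t \<Longrightarrow> good A s \<Longrightarrow> good B (App t s)"
  by (rule goodI[OF eval_App])
    (auto dest!: good_sem_reducible intro: reducible_app_good good_sem_reducible)

section \<open>String operations, case distinction and recursion\<close>

definition str_of :: "tm \<Rightarrow> bool list" where
  "str_of t = (case t of SConst m \<Rightarrow> m | _ \<Rightarrow> [])"

lemma str_of_SConst [simp]: "str_of (SConst m) = m"
  by (simp add: str_of_def)

text \<open>Puts the value distribution in the shape that the string rules of \<open>eval\<close>
  demand. The default value of \<open>str_of\<close> is never met, as a good term of type
  \<open>Str\<close> yields only string constants.\<close>

lemma good_Str_eval:
  assumes "good Str t"
  shows "eval t (map_pmf SConst (map_pmf str_of (sem t)))"
proof -
  have "map_pmf SConst (map_pmf str_of (sem t)) = map_pmf id (sem t)"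
    unfolding map_pmf_comp
    by (rule map_pmf_cong) (auto dest!: good_sem_reducible[OF assms])
  then show ?thesis
    using good_eval[OF assms] by simp
qed

lemmas eval_Zero = E_Zero[OF good_Str_eval]
  and eval_One = E_One[OF good_Str_eval]
  and eval_Tail = E_Tail[OF good_Str_eval]

lemma good_Zero: "good Str t \<Longrightarrow> good Str (Zero t)"
  and good_One: "good Str t \<Longrightarrow> good Str (One t)"
  and good_Tail: "good Str t \<Longrightarrow> good Str (Tail t)"
  by (auto intro!: goodI[OF eval_Zero] goodI[OF eval_One] goodI[OF eval_Tail])

lemma eval_Case:
  assumes "good Str t" "\<And>m. good A (case_cont t0 t1 te m)"
  shows "eval (Case B t t0 t1 te) (bind_pmf (map_pmf str_of (sem t)) (\<lambda>m. sem (case_cont t0 t1 te m)))"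
  by (rule E_Case[OF good_Str_eval]) (use assms good_eval in auto)

lemma eval_Rec:
  assumes "good Str t" "\<And>m. good A (rec_cont B t0 t1 te m)"
  shows "eval (Rec B t t0 t1 te) (bind_pmf (map_pmf str_of (sem t)) (\<lambda>m. sem (rec_cont B t0 t1 te m)))"
  by (rule E_Rec[OF good_Str_eval]) (use assms good_eval in auto)

lemma good_case_cont:
  "good A t0 \<Longrightarrow> good A t1 \<Longrightarrow> good A te \<Longrightarrow> good A (case_cont t0 t1 te m)"
  by (cases m) auto

lemma good_Case:
  assumes "good Str t" "good A t0" "good A t1" "good A te"
  shows "good A (Case B t t0 t1 te)"
  by (rule goodI[OF eval_Case[OF assms(1) good_case_cont[OF assms(2-4)]]])
    (use good_sem_reducible[OF good_case_cont[OF assms(2-4)]] in auto)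

lemma good_SConst [simp]: "good Str (SConst m)"
  by (rule reducible_good) simp

lemma sem_SConst [simp]: "sem (SConst m) = return_pmf (SConst m)"
  by (simp add: sem_value is_value.intros)

text \<open>Induction on the string recursed on: the recursive call runs on the tail
  \<open>n\<close>, is good by the induction hypothesis, and is then an ordinary argument of the
  step function.\<close>

lemma good_rec_cont:
  assumes "good (Fun a Str (Fun b A A)) t0" "good (Fun a Str (Fun b A A)) t1" "good A te"
  shows "good A (rec_cont B t0 t1 te m)"
proof (induction m)
  case Nil
  then show ?case by (simp add: assms)
next
  case (Cons c n)
  have "good A (Rec B (SConst n) t0 t1 te)"
    by (rule goodI[OF E_Rec[of _ "return_pmf n" _ _ _ _ "\<lambda>m. sem (rec_cont B t0 t1 te n)"]])
      (use Cons.IH good_eval[OF Cons.IH] good_sem_reducible[OF Cons.IH] in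
        \<open>auto simp: bind_return_pmf intro: E_Val is_value.intros\<close>)
  then show ?case
    using assms by (cases c) (auto intro!: good_App[of b A A] good_App[of a Str "Fun b A A"])
qed

lemma good_Rec:
  assumes "good Str t" "good (Fun a Str (Fun b A A)) t0" "good (Fun a Str (Fun b A A)) t1" "good A te"
  shows "good A (Rec B t t0 t1 te)"
  by (rule goodI[OF eval_Rec[OF assms(1) good_rec_cont[OF assms(2-4)]]])
    (use good_sem_reducible[OF good_rec_cont[OF assms(2-4)]] in auto)

lemma sem_Rec_SConst:
  assumes "good (Fun a Str (Fun b A A)) t0" "good (Fun a Str (Fun b A A)) t1" "good A te"
  shows "sem (Rec B (SConst n) t0 t1 te) = sem (rec_cont B t0 t1 te n)"
  using sem_eqI[OF eval_Rec[of "SConst n", OF _ good_rec_cont[OF assms]]]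
  by (simp add: bind_return_pmf)

lemma good_Rand: "good Str Rand"
  by (rule goodI[OF E_Rand]) auto

section \<open>Linear term families\<close>

text \<open>In a family \<open>f\<close> whose index occurs at most once, the index may be drawn from
  either of two indistinguishable distributions \<open>E\<close> and \<open>E'\<close> before evaluation.\<close>

definition lin_eq :: "'i pmf \<Rightarrow> 'i pmf \<Rightarrow> ty \<Rightarrow> ('i \<Rightarrow> tm) \<Rightarrow> bool" where
  "lin_eq E E' A f \<longleftrightarrow> (\<forall>i\<in>set_pmf E \<union> set_pmf E'. good A (f i)) \<and>
     tr_eq A (bind_pmf E (\<lambda>i. sem (f i))) (bind_pmf E' (\<lambda>i. sem (f i)))"

lemma lin_eq_const: "good A t \<Longrightarrow> lin_eq E E' A (\<lambda>_. t)"
  by (simp add: lin_eq_def)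

lemma lin_eq_subty: "lin_eq E E' A f \<Longrightarrow> subty A B \<Longrightarrow> lin_eq E E' B f"
  by (auto simp: lin_eq_def intro: subty_good subty_tr_eq)

text \<open>Drawing the argument value \<open>w\<close> commutes with drawing the index. For each
  fixed \<open>w\<close>, what remains is exactly the test by which \<open>tr_eq\<close> at a
  function type is defined.\<close>

lemma lin_eq_AppL:
  assumes f: "lin_eq E E' (Fun a A B) f" and s: "good A s"
  shows "lin_eq E E' B (\<lambda>i. App (f i) s)"
proof -
  have "bind_pmf X (\<lambda>i. sem (App (f i) s)) =
      bind_pmf (sem s) (\<lambda>w. bind_pmf (bind_pmf X (\<lambda>i. sem (f i))) (\<lambda>g. sem (App g w)))"
    if "\<forall>i\<in>set_pmf X. good (Fun a A B) (f i)" for X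
  proof -
    have "bind_pmf X (\<lambda>i. sem (App (f i) s)) =
        bind_pmf X (\<lambda>i. bind_pmf (sem (f i)) (\<lambda>g. bind_pmf (sem s) (\<lambda>w. sem (App g w))))"
      using that s by (intro bind_pmf_cong HOL.refl sem_App) auto
    also have "\<dots> = bind_pmf (bind_pmf X (\<lambda>i. sem (f i))) (\<lambda>g. bind_pmf (sem s) (\<lambda>w. sem (App g w)))"
      by (simp add: bind_assoc_pmf)
    finally show ?thesis
      by (subst (asm) bind_commute_pmf)
  qed
  then show ?thesis
    using assms unfolding lin_eq_def
    by (auto intro!: tr_eq_bind good_App[of a] dest: good_sem_reducible)
qed

text \<open>After the function value \<open>g\<close> is drawn first, its reducibility supplies the
  claim: it carries trace equal mixtures of reducible arguments to trace equal results.\<close>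

lemma lin_eq_AppR:
  assumes t: "good (Fun a A B) t" and f: "lin_eq E E' A f"
  shows "lin_eq E E' B (\<lambda>i. App t (f i))"
proof -
  have eq: "bind_pmf X (\<lambda>i. sem (App t (f i))) =
      bind_pmf (sem t) (\<lambda>g. bind_pmf (bind_pmf X (\<lambda>i. sem (f i))) (\<lambda>w. sem (App g w)))"
    if "\<forall>i\<in>set_pmf X. good A (f i)" for X
  proof -
    have "bind_pmf X (\<lambda>i. sem (App t (f i))) =
        bind_pmf X (\<lambda>i. bind_pmf (sem t) (\<lambda>g. bind_pmf (sem (f i)) (\<lambda>w. sem (App g w))))"
      using that t by (intro bind_pmf_cong HOL.refl sem_App) auto
    then show ?thesis
      by (subst (asm) bind_commute_pmf) (simp add: bind_assoc_pmf)
  qed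
  have "tr_eq B (bind_pmf (bind_pmf E (\<lambda>i. sem (f i))) (\<lambda>w. sem (App g w)))
      (bind_pmf (bind_pmf E' (\<lambda>i. sem (f i))) (\<lambda>w. sem (App g w)))" if "g \<in> set_pmf (sem t)" for g
  proof -
    have "\<forall>w\<in>set_pmf (bind_pmf E (\<lambda>i. sem (f i))) \<union> set_pmf (bind_pmf E' (\<lambda>i. sem (f i))). reducible A w"
      using f by (auto simp: lin_eq_def dest: good_sem_reducible)
    then show ?thesis
      using f good_sem_reducible[OF t that] by (simp add: lin_eq_def)
  qed
  then show ?thesis
    using assms eq unfolding lin_eq_def
    by (auto intro!: tr_eq_bind good_App[of a])
qed

lemma lin_eq_StrD:
  assumes "lin_eq E E' Str f"
  shows "bind_pmf E (\<lambda>i. bind_pmf (sem (f i)) K) = bind_pmf E' (\<lambda>i. bind_pmf (sem (f i)) K)"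
  using assms by (simp add: lin_eq_def flip: bind_assoc_pmf)

text \<open>Distributions on strings are trace equal only if they are equal, so a string valued
  family may be evaluated by any strict construct.\<close>

lemma lin_eq_strict:
  assumes f: "lin_eq E E' Str f"
    and G: "\<And>t. good Str t \<Longrightarrow> good A (G t)" "\<And>t. good Str t \<Longrightarrow> sem (G t) = bind_pmf (sem t) K"
  shows "lin_eq E E' A (\<lambda>i. G (f i))"
proof -
  have "bind_pmf X (\<lambda>i. sem (G (f i))) = bind_pmf X (\<lambda>i. bind_pmf (sem (f i)) K)"
    if "\<forall>i\<in>set_pmf X. good Str (f i)" for X
    using that by (intro bind_pmf_cong HOL.refl G) auto
  then show ?thesis
    using f G(1) lin_eq_StrD[OF f, of K] by (simp add: lin_eq_def)
qed

lemma lin_eq_Zero: "lin_eq E E' Str f \<Longrightarrow> lin_eq E E' Str (\<lambda>i. Zero (f i))"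
  by (erule lin_eq_strict[of _ _ _ _ Zero "\<lambda>v. return_pmf (SConst (False # str_of v))"])
    (auto simp: good_Zero sem_eqI[OF eval_Zero] map_pmf_def bind_assoc_pmf bind_return_pmf)

lemma lin_eq_One: "lin_eq E E' Str f \<Longrightarrow> lin_eq E E' Str (\<lambda>i. One (f i))"
  by (erule lin_eq_strict[of _ _ _ _ One "\<lambda>v. return_pmf (SConst (True # str_of v))"])
    (auto simp: good_One sem_eqI[OF eval_One] map_pmf_def bind_assoc_pmf bind_return_pmf)

lemma lin_eq_Tail: "lin_eq E E' Str f \<Longrightarrow> lin_eq E E' Str (\<lambda>i. Tail (f i))"
  by (erule lin_eq_strict[of _ _ _ _ Tail "\<lambda>v. return_pmf (SConst (tl (str_of v)))"])
    (auto simp: good_Tail sem_eqI[OF eval_Tail] map_pmf_def bind_assoc_pmf bind_return_pmf)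

lemma lin_eq_Case_scrut:
  assumes "lin_eq E E' Str f" "good A t0" "good A t1" "good A te"
  shows "lin_eq E E' A (\<lambda>i. Case B (f i) t0 t1 te)"
  using lin_eq_strict[of _ _ _ A "\<lambda>t. Case B t t0 t1 te" "\<lambda>v. sem (case_cont t0 t1 te (str_of v))"]
    sem_eqI[OF eval_Case[OF _ good_case_cont]] assms
  by (simp add: good_Case bind_map_pmf)

lemma lin_eq_Rec_scrut:
  assumes "lin_eq E E' Str f"
    and "good (Fun a Str (Fun b A A)) t0" "good (Fun a Str (Fun b A A)) t1" "good A te"
  shows "lin_eq E E' A (\<lambda>i. Rec B (f i) t0 t1 te)"
  using lin_eq_strict[of _ _ _ A "\<lambda>t. Rec B t t0 t1 te" "\<lambda>v. sem (rec_cont B t0 t1 te (str_of v))"]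
    sem_eqI[OF eval_Rec[OF _ good_rec_cont]] assms
  by (simp add: good_Rec bind_map_pmf)

text \<open>The scrutinee does not depend on the index, so its string \<open>m\<close> can be drawn
  first; each continuation is then treated separately and the results are mixed by
  \<open>tr_eq_bind\<close>.\<close>

lemma lin_eq_bind_cont:
  assumes "good Str t" "\<And>m. lin_eq E E' A (\<lambda>i. K i m)"
    and "\<And>i. i \<in> set_pmf E \<union> set_pmf E' \<Longrightarrow>
      good A (G i) \<and> sem (G i) = bind_pmf (map_pmf str_of (sem t)) (\<lambda>m. sem (K i m))"
  shows "lin_eq E E' A G"
proof -
  have "bind_pmf X (\<lambda>i. sem (G i)) =
      bind_pmf (map_pmf str_of (sem t)) (\<lambda>m. bind_pmf X (\<lambda>i. sem (K i m)))"
    if "set_pmf X \<subseteq> set_pmf E \<union> set_pmf E'" for X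
  proof -
    have "bind_pmf X (\<lambda>i. sem (G i)) =
        bind_pmf X (\<lambda>i. bind_pmf (map_pmf str_of (sem t)) (\<lambda>m. sem (K i m)))"
      using that assms(3) by (intro bind_pmf_cong) auto
    then show ?thesis
      by (subst (asm) bind_commute_pmf)
  qed
  then show ?thesis
    using assms unfolding lin_eq_def by (auto intro!: tr_eq_bind)
qed

text \<open>The index may occur in all three branches, because a run continues with only one of them
  and so still uses it once.\<close>

lemma lin_eq_Case_branches:
  assumes t: "good Str t"
    and f: "lin_eq E E' A f0" "lin_eq E E' A f1" "lin_eq E E' A fe"
  shows "lin_eq E E' A (\<lambda>i. Case B t (f0 i) (f1 i) (fe i))"
proof (rule lin_eq_bind_cont[OF t])
  show "lin_eq E E' A (\<lambda>i. case_cont (f0 i) (f1 i) (fe i) m)" for m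
  proof (cases m)
    case (Cons c n)
    then show ?thesis using f by (cases c) auto
  qed (use f in simp)
  fix i assume "i \<in> set_pmf E \<union> set_pmf E'"
  then have g: "good A (f0 i)" "good A (f1 i)" "good A (fe i)"
    using f by (auto simp: lin_eq_def)
  then show "good A (Case B t (f0 i) (f1 i) (fe i)) \<and> sem (Case B t (f0 i) (f1 i) (fe i)) =
      bind_pmf (map_pmf str_of (sem t)) (\<lambda>m. sem (case_cont (f0 i) (f1 i) (fe i) m))"
    using t good_Case sem_eqI[OF eval_Case[OF t good_case_cont[OF g]]] by blast
qed

text \<open>Unfolding the recursion copies the step functions but reaches the base term once, in
  argument position below all of them; each layer is one use of \<open>lin_eq_AppR\<close>.\<close>

lemma lin_eq_Rec_base:
  assumes t: "good Str t" "good (Fun a Str (Fun b A A)) t0" "good (Fun a Str (Fun b A A)) t1"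
    and f: "lin_eq E E' A f"
  shows "lin_eq E E' A (\<lambda>i. Rec B t t0 t1 (f i))"
proof (rule lin_eq_bind_cont[OF t(1)])
  show "lin_eq E E' A (\<lambda>i. rec_cont B t0 t1 (f i) m)" for m
  proof (induction m)
    case Nil
    then show ?case using f by simp
  next
    case (Cons c n)
    \<comment> \<open>A recursion on the constant \<open>n\<close> means the same as its unfolding
      \<open>rec_cont\<close> at \<open>n\<close>, so the induction hypothesis transfers.\<close>
    have "lin_eq E E' A (\<lambda>i. Rec B (SConst n) t0 t1 (f i))"
      using Cons.IH f unfolding lin_eq_def
      by (auto simp: good_Rec[OF _ t(2,3)] sem_Rec_SConst[OF t(2,3)] cong: bind_pmf_cong)
    then show ?case
      using t by (cases c) (auto intro!: lin_eq_AppR[of b A A] good_App[of a Str "Fun b A A"])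
  qed
  fix i assume "i \<in> set_pmf E \<union> set_pmf E'"
  then have g: "good A (f i)"
    using f by (auto simp: lin_eq_def)
  then show "good A (Rec B t t0 t1 (f i)) \<and> sem (Rec B t t0 t1 (f i)) =
      bind_pmf (map_pmf str_of (sem t)) (\<lambda>m. sem (rec_cont B t0 t1 (f i) m))"
    using good_Rec[OF t g] sem_eqI[OF eval_Rec[OF t(1) good_rec_cont[OF t(2,3) g]]] by blast
qed

text \<open>Abstractions are values, so their mixture is observed only through arguments, and each
  fixed argument turns it into the mixture of the substituted bodies.\<close>

lemma lin_eq_Lam:
  assumes "\<And>i. i \<in> set_pmf E \<union> set_pmf E' \<Longrightarrow> good (Fun a A B) (Lam a A (f i))"
    and "\<And>w. reducible A w \<Longrightarrow> lin_eq E E' B (\<lambda>i. subst 0 w (f i))"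
  shows "lin_eq E E' (Fun a A B) (\<lambda>i. Lam a A (f i))"
  using assms
  by (simp add: lin_eq_def sem_value is_value.intros bind_assoc_pmf bind_return_pmf sem_beta
      reducible_is_value)

lemma reducible_Lam:
  assumes "closed_typing (Lam a A r) (Fun a A B)"
    and "\<And>w. reducible A w \<Longrightarrow> good B (subst 0 w r)"
    and "\<And>E E'. (\<forall>w\<in>set_pmf E \<union> set_pmf E'. reducible A w) \<Longrightarrow> tr_eq A E E' \<Longrightarrow>
      lin_eq E E' B (\<lambda>w. subst 0 w r)"
  shows "reducible (Fun a A B) (Lam a A r)"
proof -
  have "tr_eq B (bind_pmf E (\<lambda>w. sem (App (Lam a A r) w))) (bind_pmf E' (\<lambda>w. sem (App (Lam a A r) w)))"
    if E: "\<forall>w\<in>set_pmf E \<union> set_pmf E'. reducible A w" "tr_eq A E E'" for E E'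
  proof -
    have "bind_pmf X (\<lambda>w. sem (App (Lam a A r) w)) = bind_pmf X (\<lambda>w. sem (subst 0 w r))"
      if "set_pmf X \<subseteq> set_pmf E \<union> set_pmf E'" for X
      using that E(1) by (intro bind_pmf_cong HOL.refl sem_beta) (auto dest: reducible_is_value)
    then show ?thesis
      using assms(3)[OF E] by (simp add: lin_eq_def)
  qed
  moreover have "good B (App (Lam a A r) w)" if "reducible A w" for w
    using assms(2)[OF that] good_beta[OF reducible_is_value[OF that]] by blast
  ultimately show ?thesis
    using assms(1) by (auto simp: good_def)
qed

section \<open>The fundamental lemma\<close>

text \<open>Closedness is required at every index, also outside the domain of \<Gamma>, because
  \<open>subst_msub\<close> relies on it.\<close>

definition env :: "(nat \<Rightarrow> tm) \<Rightarrow> tctx \<Rightarrow> bool" where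
  "env \<sigma> \<Gamma> \<longleftrightarrow> closed_env \<sigma> \<and> (\<forall>n a A. \<Gamma> n = Some (a, A) \<longrightarrow> reducible A (\<sigma> n))"

lemma env_closed: "env \<sigma> \<Gamma> \<Longrightarrow> closed_env \<sigma>"
  by (simp add: env_def)

lemma env_mono: "env \<sigma> \<Gamma> \<Longrightarrow> \<Delta> \<subseteq>\<^sub>m \<Gamma> \<Longrightarrow> env \<sigma> \<Delta>"
  by (auto simp: env_def map_le_iff)

lemma env_upd: "env \<sigma> \<Gamma> \<Longrightarrow> \<Gamma> z = Some (a, A) \<Longrightarrow> reducible A w \<Longrightarrow> env (\<sigma>(z := w)) \<Gamma>"
  by (auto simp: env_def dest: reducible_typed)

lemma env_case_nat:
  assumes "env \<sigma> \<Gamma>" "reducible A w"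
  shows "env (case_nat w \<sigma>) (bind_var a A \<Gamma>)"
  unfolding env_def
proof (intro conjI allI impI)
  fix n
  show "\<exists>A. closed_typing (case_nat w \<sigma> n) A"
    using assms by (cases n) (auto simp: env_def dest: reducible_typed)
next
  fix n b B assume "bind_var a A \<Gamma> n = Some (b, B)"
  then show "reducible B (case_nat w \<sigma> n)"
    using assms by (cases n) (auto simp: env_def)
qed

lemma env_typed: "env \<sigma> \<Gamma> \<Longrightarrow> \<Gamma> n = Some (a, A) \<Longrightarrow> closed_typing (\<sigma> n) A"
  by (simp add: env_def reducible_typed)

lemma msub_upd: "typing \<Gamma> t A \<Longrightarrow> z \<notin> dom \<Gamma> \<Longrightarrow> msub 0 (\<sigma>(z := w)) t = msub 0 \<sigma> t"
  by (rule msub_cong) auto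

lemma str_ctx_Some: "str_ctx \<Gamma> \<Longrightarrow> \<Gamma> n = Some (a, A) \<Longrightarrow> A = Str"
  by (auto simp: str_ctx_def ran_def)

lemma disjoint_ctxs_at:
  "disjoint_ctxs \<Gamma>s \<Longrightarrow> sorted_wrt (\<lambda>\<Gamma> \<Delta>. \<Gamma> z = None \<or> \<Delta> z = None) \<Gamma>s"
  unfolding disjoint_ctxs_def by (erule sorted_wrt_mono_rel[rotated]) (metis disjoint_iff domIff)

definition good_in :: "tctx \<Rightarrow> tm \<Rightarrow> ty \<Rightarrow> bool" where
  "good_in \<Gamma> t B \<longleftrightarrow> (\<forall>\<sigma>. env \<sigma> \<Gamma> \<longrightarrow> good B (msub 0 \<sigma> t))"

text \<open>Randomising one variable at a time is enough: reducibility of an abstraction concerns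
  only its bound variable, and linearity of an abstraction in an outer variable is tested with the
  bound one fixed.\<close>

definition lin_in :: "tctx \<Rightarrow> tm \<Rightarrow> ty \<Rightarrow> bool" where
  "lin_in \<Gamma> t B \<longleftrightarrow> (\<forall>\<sigma> z a A E E'. env \<sigma> \<Gamma> \<longrightarrow> \<Gamma> z = Some (a, A) \<longrightarrow>
     (\<forall>w\<in>set_pmf E \<union> set_pmf E'. reducible A w) \<longrightarrow> tr_eq A E E' \<longrightarrow>
     lin_eq E E' B (\<lambda>w. msub 0 (\<sigma>(z := w)) t))"

lemma good_inD: "good_in \<Gamma> t B \<Longrightarrow> env \<sigma> \<Gamma> \<Longrightarrow> good B (msub 0 \<sigma> t)"
  by (simp add: good_in_def)

lemma lin_inD:
  "lin_in \<Gamma> t B \<Longrightarrow> env \<sigma> \<Gamma> \<Longrightarrow> \<Gamma> z = Some (a, A) \<Longrightarrow>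
    (\<And>w. w \<in> set_pmf E \<union> set_pmf E' \<Longrightarrow> reducible A w) \<Longrightarrow> tr_eq A E E' \<Longrightarrow>
    lin_eq E E' B (\<lambda>w. msub 0 (\<sigma>(z := w)) t)"
  unfolding lin_in_def by blast

text \<open>A string variable may occur several times, but trace equal distributions on strings
  are equal.\<close>

lemma lin_inI:
  assumes g: "good_in \<Gamma> t B"
    and lin: "\<And>\<sigma> z a A E E'. env \<sigma> \<Gamma> \<Longrightarrow> \<Gamma> z = Some (a, A) \<Longrightarrow> A \<noteq> Str \<Longrightarrow>
      (\<And>w. w \<in> set_pmf E \<union> set_pmf E' \<Longrightarrow> reducible A w) \<Longrightarrow> tr_eq A E E' \<Longrightarrow>
      lin_eq E E' B (\<lambda>w. msub 0 (\<sigma>(z := w)) t)"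
  shows "lin_in \<Gamma> t B"
  unfolding lin_in_def
proof (intro allI impI)
  fix \<sigma> z a A E E'
  assume *: "env \<sigma> \<Gamma>" "\<Gamma> z = Some (a, A)" "\<forall>w\<in>set_pmf E \<union> set_pmf E'. reducible A w" "tr_eq A E E'"
  show "lin_eq E E' B (\<lambda>w. msub 0 (\<sigma>(z := w)) t)"
  proof (cases "A = Str")
    case True
    then have "E = E'"
      using *(4) by simp
    moreover have "good B (msub 0 (\<sigma>(z := w)) t)" if "w \<in> set_pmf E" for w
      using that * by (intro good_inD[OF g] env_upd[OF *(1,2)]) auto
    ultimately show ?thesis
      by (simp add: lin_eq_def)
  next
    case False
    then show ?thesis
      using lin * by blast
  qed
qed

lemma lin_eq_cong:
  assumes "\<And>i. i \<in> set_pmf E \<union> set_pmf E' \<Longrightarrow> f i = g i"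
  shows "lin_eq E E' A f \<longleftrightarrow> lin_eq E E' A g"
proof -
  have "bind_pmf E (\<lambda>i. sem (f i)) = bind_pmf E (\<lambda>i. sem (g i))"
    "bind_pmf E' (\<lambda>i. sem (f i)) = bind_pmf E' (\<lambda>i. sem (g i))"
    using assms by (auto intro!: bind_pmf_cong)
  then show ?thesis
    using assms by (simp add: lin_eq_def)
qed

text \<open>The halves must be proved together: reducibility of an abstraction contains linearity of
  its body, and linearity of a compound term needs goodness of the parts that avoid the
  variable.\<close>

theorem fundamental: "typing \<Gamma> t B \<Longrightarrow> good_in \<Gamma> t B \<and> lin_in \<Gamma> t B"
proof (induction rule: typing.induct)
  case (T_Var \<Gamma> n a A)
  have g: "good_in \<Gamma> (Var n) A"
    using T_Var by (auto simp: good_in_def env_def intro: reducible_good)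
  moreover have "lin_in \<Gamma> (Var n) A"
  proof (rule lin_inI[OF g])
    fix \<sigma> z b B E E'
    assume *: "env \<sigma> \<Gamma>" "\<Gamma> z = Some (b, B)"
      "\<And>w. w \<in> set_pmf E \<union> set_pmf E' \<Longrightarrow> reducible B w" "tr_eq B E E'"
    show "lin_eq E E' A (\<lambda>w. msub 0 (\<sigma>(z := w)) (Var n))"
    proof (cases "n = z")
      case True
      then have "B = A"
        using * T_Var by simp
      have "bind_pmf X sem = X" if "set_pmf X \<subseteq> set_pmf E \<union> set_pmf E'" for X
      proof -
        have "bind_pmf X sem = bind_pmf X return_pmf"
          by (intro bind_pmf_cong HOL.refl sem_value reducible_is_value[OF *(3)]) (use that in auto)
        then show ?thesis
          by (simp add: bind_return_pmf')
      qed
      then show ?thesis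
        using True * \<open>B = A\<close> by (simp add: lin_eq_def reducible_good)
    next
      case False
      then show ?thesis
        using good_inD[OF g *(1)] by (simp add: lin_eq_const)
    qed
  qed
  ultimately show ?case ..
next
  case (T_SConst \<Gamma> m)
  then show ?case by (simp add: good_in_def lin_in_def lin_eq_const)
next
  case (T_Rand \<Gamma>)
  then show ?case by (simp add: good_in_def lin_in_def lin_eq_const good_Rand)
next
  case (T_Zero \<Gamma> t)
  then show ?case by (simp add: good_in_def lin_in_def lin_eq_Zero good_Zero)
next
  case (T_One \<Gamma> t)
  then show ?case by (simp add: good_in_def lin_in_def lin_eq_One good_One)
next
  case (T_Tail \<Gamma> t)
  then show ?case by (simp add: good_in_def lin_in_def lin_eq_Tail good_Tail)
next
  case (T_Sub \<Gamma> t A B)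
  then show ?case
    unfolding good_in_def lin_in_def by (meson subty_good lin_eq_subty)
next
  case (T_Lam a A \<Gamma> t B)
  then have g: "good_in (bind_var a A \<Gamma>) t B" and l: "lin_in (bind_var a A \<Gamma>) t B"
    by auto
  have red: "reducible (Fun a A B) (Lam a A (msub (Suc 0) \<sigma> t))" if \<sigma>: "env \<sigma> \<Gamma>" for \<sigma>
  proof (rule reducible_Lam)
    have "closed_typing (msub 0 \<sigma> (Lam a A t)) (Fun a A B)"
      using typing.T_Lam[OF T_Lam.hyps] env_typed[OF \<sigma>] by (rule closed_typing_msub)
    then show "closed_typing (Lam a A (msub (Suc 0) \<sigma> t)) (Fun a A B)"
      by simp
    show "good B (subst 0 w (msub (Suc 0) \<sigma> t))" if "reducible A w" for w
      using good_inD[OF g env_case_nat[OF \<sigma> that]] by (simp add: subst_msub env_closed[OF \<sigma>])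
    fix E E' assume E: "\<forall>w\<in>set_pmf E \<union> set_pmf E'. reducible A w" "tr_eq A E E'"
    \<comment> \<open>\<open>lin_inD\<close> asks for a full environment before it overwrites
      variable 0. The placeholder comes from the nonempty support of \<open>E\<close>, and its
      choice is immaterial.\<close>
    obtain w0 where "reducible A w0"
      using E(1) set_pmf_not_empty[of E] by auto
    moreover have "(case_nat w0 \<sigma>)(0 := w) = case_nat w \<sigma>" for w
      by (auto simp: fun_eq_iff split: nat.splits)
    ultimately show "lin_eq E E' B (\<lambda>w. subst 0 w (msub (Suc 0) \<sigma> t))"
      using lin_inD[OF l env_case_nat[OF \<sigma>], of w0 0 a A E E'] E
      by (simp add: subst_msub env_closed[OF \<sigma>])
  qed
  then have good: "good_in \<Gamma> (Lam a A t) (Fun a A B)"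
    by (simp add: good_in_def reducible_good)
  moreover have "lin_in \<Gamma> (Lam a A t) (Fun a A B)"
  proof (rule lin_inI[OF good])
    fix \<sigma> z b C E E'
    assume *: "env \<sigma> \<Gamma>" "\<Gamma> z = Some (b, C)"
      "\<And>w. w \<in> set_pmf E \<union> set_pmf E' \<Longrightarrow> reducible C w" "tr_eq C E E'"
    have \<sigma>: "env (\<sigma>(z := i)) \<Gamma>" if "i \<in> set_pmf E \<union> set_pmf E'" for i
      using env_upd[OF *(1,2)] *(3)[OF that] by blast
    have "lin_eq E E' (Fun a A B) (\<lambda>i. Lam a A (msub (Suc 0) (\<sigma>(z := i)) t))"
    proof (rule lin_eq_Lam)
      show "good (Fun a A B) (Lam a A (msub (Suc 0) (\<sigma>(z := i)) t))"
        if "i \<in> set_pmf E \<union> set_pmf E'" for i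
        using red[OF \<sigma>[OF that]] by (rule reducible_good)
      fix w assume w: "reducible A w"
      \<comment> \<open>Under the binder the outer variable \<open>z\<close> has index
        \<open>Suc z\<close>, and the bound variable is held at \<open>w\<close>.\<close>
      have "lin_eq E E' B (\<lambda>i. msub 0 ((case_nat w \<sigma>)(Suc z := i)) t)"
        using * by (intro lin_inD[OF l env_case_nat[OF *(1) w], of "Suc z"]) auto
      moreover have "subst 0 w (msub (Suc 0) (\<sigma>(z := i)) t) = msub 0 ((case_nat w \<sigma>)(Suc z := i)) t"
        if "i \<in> set_pmf E \<union> set_pmf E'" for i
      proof -
        have "case_nat w (\<sigma>(z := i)) = (case_nat w \<sigma>)(Suc z := i)"
          by (auto simp: fun_eq_iff split: nat.splits)
        then show ?thesis
          by (simp only: subst_msub[OF env_closed[OF \<sigma>[OF that]]])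
      qed
      ultimately show "lin_eq E E' B (\<lambda>i. subst 0 w (msub (Suc 0) (\<sigma>(z := i)) t))"
        by (subst lin_eq_cong)
    qed
    then show "lin_eq E E' (Fun a A B) (\<lambda>i. msub 0 (\<sigma>(z := i)) (Lam a A t))"
      by simp
  qed
  ultimately show ?case ..
next
  case (T_App \<Gamma> \<Delta>1 \<Delta>2 t a A B s)
  let ?\<Gamma> = "\<Gamma> ++ \<Delta>1 ++ \<Delta>2"
  note mono = map_le_App[OF T_App.hyps(1), THEN env_mono[rotated]]
  have t: "good (Fun a A B) (msub 0 \<sigma> t)" and s: "good A (msub 0 \<sigma> s)" if "env \<sigma> ?\<Gamma>" for \<sigma>
    using that T_App.IH good_inD mono by blast+
  then have g: "good_in ?\<Gamma> (App t s) B"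
    by (auto simp: good_in_def intro: good_App)
  moreover have "lin_in ?\<Gamma> (App t s) B"
  proof (rule lin_inI[OF g])
    fix \<sigma> z b C E E'
    assume *: "env \<sigma> ?\<Gamma>" "?\<Gamma> z = Some (b, C)" "C \<noteq> Str"
      and E: "\<And>w. w \<in> set_pmf E \<union> set_pmf E' \<Longrightarrow> reducible C w" "tr_eq C E E'"
    note part = lin_inD[OF _ _ _ E]
    \<comment> \<open>The shared part declares only strings, while \<open>C\<close> is not
      \<open>Str\<close>. So \<open>z\<close> is visible to just one of the two subterms, and the
      other is constant in the drawn value.\<close>
    have "\<Gamma> z = None"
      using *(2,3) disjoint_ctxs_at[OF T_App.hyps(1), of z] str_ctx_Some[OF T_App.hyps(2), of z]
      by (cases "\<Gamma> z") (auto simp: map_add_Some_iff)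
    with *(2) disjoint_ctxs_at[OF T_App.hyps(1), of z] consider
        "(\<Gamma> ++ \<Delta>1) z = Some (b, C)" "z \<notin> dom (\<Gamma> ++ \<Delta>2)"
      | "(\<Gamma> ++ \<Delta>2) z = Some (b, C)" "z \<notin> dom (\<Gamma> ++ \<Delta>1)"
      by (auto simp: map_add_Some_iff domIff)
    then show "lin_eq E E' B (\<lambda>w. msub 0 (\<sigma>(z := w)) (App t s))"
    proof cases
      case 1
      then show ?thesis
        using lin_eq_AppL[OF part[OF conjunct2[OF T_App.IH(1)] mono(1)[OF *(1)] 1(1)] s[OF *(1)]]
        by (simp add: msub_upd[OF T_App.hyps(4)])
    next
      case 2
      then show ?thesis
        using lin_eq_AppR[OF t[OF *(1)] part[OF conjunct2[OF T_App.IH(2)] mono(2)[OF *(1)] 2(1)]]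
        by (simp add: msub_upd[OF T_App.hyps(3)])
    qed
  qed
  ultimately show ?case ..
next
  case (T_Case \<Gamma> \<Delta>1 \<Delta>2 \<Delta>3 \<Delta>4 t t0 A t1 te)
  let ?\<Gamma> = "\<Gamma> ++ \<Delta>1 ++ \<Delta>2 ++ \<Delta>3 ++ \<Delta>4"
  note mono = map_le_Case[OF T_Case.hyps(1), THEN env_mono[rotated]]
  have good: "good Str (msub 0 \<sigma> t)" "good A (msub 0 \<sigma> t0)" "good A (msub 0 \<sigma> t1)"
    "good A (msub 0 \<sigma> te)" if "env \<sigma> ?\<Gamma>" for \<sigma>
    using that T_Case.IH good_inD mono by blast+
  then have g: "good_in ?\<Gamma> (Case A t t0 t1 te) A"
    by (simp add: good_in_def good_Case)
  moreover have "lin_in ?\<Gamma> (Case A t t0 t1 te) A"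
  proof (rule lin_inI[OF g])
    fix \<sigma> z b C E E'
    assume *: "env \<sigma> ?\<Gamma>" "?\<Gamma> z = Some (b, C)" "C \<noteq> Str"
      and E: "\<And>w. w \<in> set_pmf E \<union> set_pmf E' \<Longrightarrow> reducible C w" "tr_eq C E E'"
    note part = lin_inD[OF _ _ _ E]
    have "\<Gamma> z = None"
      using *(2,3) disjoint_ctxs_at[OF T_Case.hyps(1), of z] str_ctx_Some[OF T_Case.hyps(2), of z]
      by (cases "\<Gamma> z") (auto simp: map_add_Some_iff)
    with *(2) disjoint_ctxs_at[OF T_Case.hyps(1), of z] consider
        "(\<Gamma> ++ \<Delta>1) z = Some (b, C)" "z \<notin> dom (\<Gamma> ++ \<Delta>2)" "z \<notin> dom (\<Gamma> ++ \<Delta>3)" "z \<notin> dom (\<Gamma> ++ \<Delta>4)"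
      | "(\<Gamma> ++ \<Delta>2) z = Some (b, C)" "z \<notin> dom (\<Gamma> ++ \<Delta>1)" "z \<notin> dom (\<Gamma> ++ \<Delta>3)" "z \<notin> dom (\<Gamma> ++ \<Delta>4)"
      | "(\<Gamma> ++ \<Delta>3) z = Some (b, C)" "z \<notin> dom (\<Gamma> ++ \<Delta>1)" "z \<notin> dom (\<Gamma> ++ \<Delta>2)" "z \<notin> dom (\<Gamma> ++ \<Delta>4)"
      | "(\<Gamma> ++ \<Delta>4) z = Some (b, C)" "z \<notin> dom (\<Gamma> ++ \<Delta>1)" "z \<notin> dom (\<Gamma> ++ \<Delta>2)" "z \<notin> dom (\<Gamma> ++ \<Delta>3)"
      by (auto simp: map_add_Some_iff domIff)
    then show "lin_eq E E' A (\<lambda>w. msub 0 (\<sigma>(z := w)) (Case A t t0 t1 te))"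
    proof cases
      case 1
      then show ?thesis
        using part[OF _ mono(1)[OF *(1)] 1(1)] T_Case.IH(1) good[OF *(1)]
        by (simp add: msub_upd[OF T_Case.hyps(4)] msub_upd[OF T_Case.hyps(5)]
            msub_upd[OF T_Case.hyps(6)] lin_eq_Case_scrut)
    next
      case 2
      then show ?thesis
        using part[OF _ mono(2)[OF *(1)] 2(1)] T_Case.IH(2) good[OF *(1)]
        by (simp add: msub_upd[OF T_Case.hyps(3)] msub_upd[OF T_Case.hyps(5)]
            msub_upd[OF T_Case.hyps(6)] lin_eq_Case_branches lin_eq_const)
    next
      case 3
      then show ?thesis
        using part[OF _ mono(3)[OF *(1)] 3(1)] T_Case.IH(3) good[OF *(1)]
        by (simp add: msub_upd[OF T_Case.hyps(3)] msub_upd[OF T_Case.hyps(4)]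
            msub_upd[OF T_Case.hyps(6)] lin_eq_Case_branches lin_eq_const)
    next
      case 4
      then show ?thesis
        using part[OF _ mono(4)[OF *(1)] 4(1)] T_Case.IH(4) good[OF *(1)]
        by (simp add: msub_upd[OF T_Case.hyps(3)] msub_upd[OF T_Case.hyps(4)]
            msub_upd[OF T_Case.hyps(5)] lin_eq_Case_branches lin_eq_const)
    qed
  qed
  ultimately show ?case ..
next
  case (T_Rec \<Gamma>1 \<Gamma>2 \<Gamma>3 \<Delta>1 \<Delta>2 t t0 A t1 te)
  let ?\<Gamma> = "\<Gamma>1 ++ \<Gamma>2 ++ \<Gamma>3 ++ \<Delta>1 ++ \<Delta>2"
  let ?S = "Fun WBox Str (Fun BBox A A)"
  note mono = map_le_Rec[OF T_Rec.hyps(1), THEN env_mono[rotated]]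
  have good: "good Str (msub 0 \<sigma> t)" "good ?S (msub 0 \<sigma> t0)" "good ?S (msub 0 \<sigma> t1)"
    "good A (msub 0 \<sigma> te)" if "env \<sigma> ?\<Gamma>" for \<sigma>
    using that T_Rec.IH good_inD mono by blast+
  then have g: "good_in ?\<Gamma> (Rec A t t0 t1 te) A"
    by (auto simp: good_in_def intro!: good_Rec)
  moreover have "lin_in ?\<Gamma> (Rec A t t0 t1 te) A"
  proof (rule lin_inI[OF g])
    fix \<sigma> z b C E E'
    assume *: "env \<sigma> ?\<Gamma>" "?\<Gamma> z = Some (b, C)" "C \<noteq> Str"
      and E: "\<And>w. w \<in> set_pmf E \<union> set_pmf E' \<Longrightarrow> reducible C w" "tr_eq C E E'"
    note part = lin_inD[OF _ _ _ E]
    \<comment> \<open>The step functions, which recursion copies, see only string variables. The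
      variable \<open>z\<close> therefore belongs to the scrutinee or to the base term.\<close>
    have "\<Gamma>1 z \<noteq> Some (b, C)" "\<Gamma>2 z \<noteq> Some (b, C)" "\<Gamma>3 z \<noteq> Some (b, C)"
      using *(3) T_Rec.hyps(2-4) str_ctx_Some by blast+
    with *(2) have "\<Delta>1 z = Some (b, C) \<or> \<Delta>2 z = Some (b, C)"
      by (auto simp: map_add_Some_iff)
    with disjoint_ctxs_at[OF T_Rec.hyps(1), of z] consider
        "(\<Gamma>1 ++ \<Delta>1) z = Some (b, C)" "z \<notin> dom (\<Gamma>1 ++ \<Gamma>2)" "z \<notin> dom (\<Gamma>1 ++ \<Gamma>3)"
          "z \<notin> dom (\<Gamma>1 ++ \<Gamma>2 ++ \<Gamma>3 ++ \<Delta>2)"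
      | "(\<Gamma>1 ++ \<Gamma>2 ++ \<Gamma>3 ++ \<Delta>2) z = Some (b, C)" "z \<notin> dom (\<Gamma>1 ++ \<Delta>1)" "z \<notin> dom (\<Gamma>1 ++ \<Gamma>2)"
          "z \<notin> dom (\<Gamma>1 ++ \<Gamma>3)"
      by (auto simp: map_add_Some_iff domIff)
    then show "lin_eq E E' A (\<lambda>w. msub 0 (\<sigma>(z := w)) (Rec A t t0 t1 te))"
    proof cases
      case 1
      then show ?thesis
        using lin_eq_Rec_scrut[OF part[OF conjunct2[OF T_Rec.IH(1)] mono(1)[OF *(1)] 1(1)]
            good(2-4)[OF *(1)]]
        by (simp add: msub_upd[OF T_Rec.hyps(6)] msub_upd[OF T_Rec.hyps(7)]
            msub_upd[OF T_Rec.hyps(8)])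
    next
      case 2
      then show ?thesis
        using lin_eq_Rec_base[OF good(1-3)[OF *(1)]
            part[OF conjunct2[OF T_Rec.IH(4)] mono(4)[OF *(1)] 2(1)]]
        by (simp add: msub_upd[OF T_Rec.hyps(5)] msub_upd[OF T_Rec.hyps(6)]
            msub_upd[OF T_Rec.hyps(7)])
    qed
  qed
  ultimately show ?case ..
qed

lemma typing_good: "typing \<Gamma> t A \<Longrightarrow> env \<sigma> \<Gamma> \<Longrightarrow> good A (msub 0 \<sigma> t)"
  using fundamental good_inD by blast

lemma env_empty: "env (\<lambda>_. SConst []) Map.empty"
  by (auto simp: env_def intro!: exI[of _ Str] typing.T_SConst)

lemma closed_good: "closed_typing t A \<Longrightarrow> good A t"
  using typing_good[OF _ env_empty] msub_closed by metis

text \<open>A value lies in the support of its own distribution, so goodness makes it reducible.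
  Together with \<open>reducible_typed\<close>, the arguments tested by \<open>tr_eq\<close> are
  exactly those that compatible traces may pass.\<close>

lemma closed_value_reducible: "closed_typing v A \<Longrightarrow> is_value v \<Longrightarrow> reducible A v"
  using good_sem_reducible[OF closed_good] sem_value by auto

section \<open>Trace equivalent terms in contexts\<close>

text \<open>A context is only typed semantically, through all its fillings. Filling it with an
  inhabitant that has no types but the supertypes of \<open>A\<close> yields one derivation that serves
  for all closed terms of type \<open>A\<close>.\<close>

primrec least_inhabitant :: "ty \<Rightarrow> tm" where
  "least_inhabitant Str = SConst []"
| "least_inhabitant (Fun a A B) = Lam a A (least_inhabitant B)"

lemma typing_least_inhabitant: "finite (dom \<Gamma>) \<Longrightarrow> typing \<Gamma> (least_inhabitant A) A"
  by (induction A arbitrary: \<Gamma>) (auto intro: typing.intros finite_dom_bind_var)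

lemma typing_SConst_subty: "typing \<Gamma> (SConst m) B \<Longrightarrow> subty Str B"
  by (induction \<Gamma> "SConst m" B rule: typing.induct) (auto intro: subty.refl subty.trans)

lemma typing_Lam_subty:
  "typing \<Gamma> (Lam a A t) B \<Longrightarrow> \<exists>C. typing (bind_var a A \<Gamma>) t C \<and> subty (Fun a A C) B"
  by (induction \<Gamma> "Lam a A t" B rule: typing.induct) (auto intro: subty.refl subty.trans)

text \<open>The annotation of the abstraction fixes aspect and domain, so inversion leaves only
  subsumption and the type of the body, which the induction hypothesis bounds from below.\<close>

lemma least_inhabitant_subty: "typing \<Gamma> (least_inhabitant A) B \<Longrightarrow> subty A B"
proof (induction A arbitrary: \<Gamma> B)
  case (Fun a A C)
  then obtain D where "typing (bind_var a A \<Gamma>) (least_inhabitant C) D" "subty (Fun a A D) B"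
    using typing_Lam_subty by fastforce
  moreover have "aspect_le a a"
    by (cases a) auto
  ultimately show ?case
    using Fun.IH(2) by (blast intro: subty.refl subty.fn subty.trans)
qed (auto dest: typing_SConst_subty)

text \<open>The index of the family is the filling itself, drawn from a point mass at
  \<open>t\<close> or at \<open>s\<close>. Induction follows the derivation of one particular
  filling, with \<open>C\<close> generalised. The typing conjunct is carried along because the
  abstraction case needs goodness of both filled abstractions.\<close>

lemma lin_eq_fill:
  assumes A: "closed_typing t A" "closed_typing s A" "tr_eq A (sem t) (sem s)"
  shows "typing \<Gamma> M B \<Longrightarrow> M = fill C (least_inhabitant A) \<Longrightarrow>
    (\<forall>u. closed_typing u A \<longrightarrow> typing \<Gamma> (fill C u) B) \<and>
    (\<forall>\<sigma>. env \<sigma> \<Gamma> \<longrightarrow> lin_eq (return_pmf t) (return_pmf s) B (\<lambda>u. msub 0 \<sigma> (fill C u)))"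
    (is "_ \<Longrightarrow> _ \<Longrightarrow> ?P \<Gamma> C B")
proof -
  have good: "good B (msub 0 \<sigma> M)" if "typing \<Gamma> M B" "env \<sigma> \<Gamma>" for \<Gamma> M B \<sigma>
    using that typing_good by blast
  \<comment> \<open>At every syntax-directed rule the context may be the bare hole or a term without
    a hole, and both are settled here once. For the hole, the inhabitant having type
    \<open>B\<close> forces \<open>subty A B\<close>.\<close>
  have base: "?P \<Gamma> C B" if "typing \<Gamma> M B" "M = fill C (least_inhabitant A)" "C = Hole \<or> C = CTerm M" for \<Gamma> M B C
    using that(3)
  proof
    assume C: "C = Hole"
    then have sub: "subty A B"
      using that least_inhabitant_subty by auto
    have "lin_eq (return_pmf t) (return_pmf s) A (msub 0 \<sigma>)" for \<sigma>
      using A by (simp add: lin_eq_def bind_return_pmf msub_closed[OF A(1)] msub_closed[OF A(2)] closed_good)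
    moreover have "typing \<Gamma> u B" if "closed_typing u A" for u
      using typing_weaken[OF that] typing_finite_dom[OF \<open>typing \<Gamma> M B\<close>] sub
      by (auto intro: T_Sub)
    ultimately show ?thesis
      using C sub by (auto intro: lin_eq_subty)
  next
    assume "C = CTerm M"
    then show ?thesis
      using that(1) good[OF that(1)] by (simp add: lin_eq_const)
  qed
  show "typing \<Gamma> M B \<Longrightarrow> M = fill C (least_inhabitant A) \<Longrightarrow> ?P \<Gamma> C B"
  proof (induction arbitrary: C rule: typing.induct)
    case (T_Sub \<Gamma> M B D)
    then show ?case
      by (blast intro: typing.T_Sub lin_eq_subty)
  next
    case (T_Var \<Gamma> n a B)
    show ?case
    proof (cases "C = Hole \<or> C = CTerm (Var n)")
      case True
      then show ?thesis
        by (rule base[OF typing.T_Var[OF T_Var.hyps] T_Var.prems])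
    next
      case False
      then show ?thesis
        using T_Var.prems by (cases C) auto
    qed
  next
    case (T_SConst \<Gamma> m)
    show ?case
    proof (cases "C = Hole \<or> C = CTerm (SConst m)")
      case True
      then show ?thesis
        by (rule base[OF typing.T_SConst[OF T_SConst.hyps] T_SConst.prems])
    next
      case False
      then show ?thesis
        using T_SConst.prems by (cases C) auto
    qed
  next
    case (T_Rand \<Gamma>)
    show ?case
    proof (cases "C = Hole \<or> C = CTerm (Rand)")
      case True
      then show ?thesis
        by (rule base[OF typing.T_Rand[OF T_Rand.hyps] T_Rand.prems])
    next
      case False
      then show ?thesis
        using T_Rand.prems by (cases C) auto
    qed
  next
    case (T_Zero \<Gamma> M)
    show ?case
    proof (cases "C = Hole \<or> C = CTerm (Zero M)")
      case True
      then show ?thesis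
        by (rule base[OF typing.T_Zero[OF T_Zero.hyps] T_Zero.prems])
    next
      case False
      with T_Zero.prems obtain C' where "C = CZero C'" "M = fill C' (least_inhabitant A)"
        by (cases C) auto
      then show ?thesis
        using T_Zero.IH[of C'] by (simp add: typing.T_Zero lin_eq_Zero)
    qed
  next
    case (T_One \<Gamma> M)
    show ?case
    proof (cases "C = Hole \<or> C = CTerm (One M)")
      case True
      then show ?thesis
        by (rule base[OF typing.T_One[OF T_One.hyps] T_One.prems])
    next
      case False
      with T_One.prems obtain C' where "C = COne C'" "M = fill C' (least_inhabitant A)"
        by (cases C) auto
      then show ?thesis
        using T_One.IH[of C'] by (simp add: typing.T_One lin_eq_One)
    qed
  next
    case (T_Tail \<Gamma> M)
    show ?case
    proof (cases "C = Hole \<or> C = CTerm (Tail M)")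
      case True
      then show ?thesis
        by (rule base[OF typing.T_Tail[OF T_Tail.hyps] T_Tail.prems])
    next
      case False
      with T_Tail.prems obtain C' where "C = CTail C'" "M = fill C' (least_inhabitant A)"
        by (cases C) auto
      then show ?thesis
        using T_Tail.IH[of C'] by (simp add: typing.T_Tail lin_eq_Tail)
    qed
  next
    case (T_Lam a B \<Gamma> M D)
    show ?case
    proof (cases "C = Hole \<or> C = CTerm (Lam a B M)")
      case True
      then show ?thesis
        by (rule base[OF typing.T_Lam[OF T_Lam.hyps] T_Lam.prems])
    next
      case False
      with T_Lam.prems obtain C' where C: "C = CLam a B C'" and M: "M = fill C' (least_inhabitant A)"
        by (cases C) auto
      note IH = T_Lam.IH[OF M]
      have ty: "typing \<Gamma> (Lam a B (fill C' u)) (Fun a B D)" if "closed_typing u A" for u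
        using IH that by (blast intro: typing.T_Lam)
      have "lin_eq (return_pmf t) (return_pmf s) (Fun a B D) (\<lambda>u. Lam a B (msub (Suc 0) \<sigma> (fill C' u)))"
        if \<sigma>: "env \<sigma> \<Gamma>" for \<sigma>
      proof (rule lin_eq_Lam)
        show "good (Fun a B D) (Lam a B (msub (Suc 0) \<sigma> (fill C' u)))"
          if "u \<in> set_pmf (return_pmf t) \<union> set_pmf (return_pmf s)" for u
          using good[OF ty \<sigma>, of u] that A by auto
        show "lin_eq (return_pmf t) (return_pmf s) D (\<lambda>u. subst 0 w (msub (Suc 0) \<sigma> (fill C' u)))"
          if "reducible B w" for w
          using IH env_case_nat[OF \<sigma> that] by (simp add: subst_msub env_closed[OF \<sigma>])
      qed
      then show ?thesis
        using ty by (simp add: C)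
    qed
  next
    case (T_App \<Gamma> \<Delta>1 \<Delta>2 M a D B N)
    show ?case
    proof (cases "C = Hole \<or> C = CTerm (App M N)")
      case True
      then show ?thesis
        by (rule base[OF typing.T_App[OF T_App.hyps] T_App.prems])
    next
      case False
      note mono = map_le_App[OF T_App.hyps(1), THEN env_mono[rotated]]
      note ty = typing.T_App[OF T_App.hyps(1,2) _ _ T_App.hyps(5)]
      from False T_App.prems consider
          C' where "C = CAppL C' N" "M = fill C' (least_inhabitant A)"
        | C' where "C = CAppR M C'" "N = fill C' (least_inhabitant A)"
        by (cases C) auto
      then show ?thesis
      proof cases
        case 1
        note IH = T_App.IH(1)[OF 1(2)]
        have "lin_eq (return_pmf t) (return_pmf s) B (\<lambda>u. App (msub 0 \<sigma> (fill C' u)) (msub 0 \<sigma> N))"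
          if "env \<sigma> (\<Gamma> ++ \<Delta>1 ++ \<Delta>2)" for \<sigma>
          by (rule lin_eq_AppL[OF _ good[OF T_App.hyps(4) mono(2)[OF that]]])
            (use IH mono(1)[OF that] in blast)
        then show ?thesis
          using ty[OF _ T_App.hyps(4)] IH by (simp add: 1(1))
      next
        case 2
        note IH = T_App.IH(2)[OF 2(2)]
        have "lin_eq (return_pmf t) (return_pmf s) B (\<lambda>u. App (msub 0 \<sigma> M) (msub 0 \<sigma> (fill C' u)))"
          if "env \<sigma> (\<Gamma> ++ \<Delta>1 ++ \<Delta>2)" for \<sigma>
          by (rule lin_eq_AppR[OF good[OF T_App.hyps(3) mono(1)[OF that]]])
            (use IH mono(2)[OF that] in blast)
        then show ?thesis
          using ty[OF T_App.hyps(3)] IH by (simp add: 2(1))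
      qed
    qed
  next
    case (T_Case \<Gamma> \<Delta>1 \<Delta>2 \<Delta>3 \<Delta>4 M M0 B M1 Me)
    show ?case
    proof (cases "C = Hole \<or> C = CTerm (Case B M M0 M1 Me)")
      case True
      then show ?thesis
        by (rule base[OF typing.T_Case[OF T_Case.hyps] T_Case.prems])
    next
      case False
      note mono = map_le_Case[OF T_Case.hyps(1), THEN env_mono[rotated]]
      note ty = typing.T_Case[OF T_Case.hyps(1,2)]
      from False T_Case.prems consider
          C' where "C = CCaseScrut B C' M0 M1 Me" "M = fill C' (least_inhabitant A)"
        | C0 C1 Ce where "C = CCaseBranch B M C0 C1 Ce" "M0 = fill C0 (least_inhabitant A)"
          "M1 = fill C1 (least_inhabitant A)" "Me = fill Ce (least_inhabitant A)"
        by (cases C) auto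
      then show ?thesis
      proof cases
        case 1
        note IH = T_Case.IH(1)[OF 1(2)]
        have "lin_eq (return_pmf t) (return_pmf s) B
            (\<lambda>u. Case B (msub 0 \<sigma> (fill C' u)) (msub 0 \<sigma> M0) (msub 0 \<sigma> M1) (msub 0 \<sigma> Me))"
          if "env \<sigma> (\<Gamma> ++ \<Delta>1 ++ \<Delta>2 ++ \<Delta>3 ++ \<Delta>4)" for \<sigma>
          by (rule lin_eq_Case_scrut[OF _ good[OF T_Case.hyps(4) mono(2)[OF that]]
                good[OF T_Case.hyps(5) mono(3)[OF that]] good[OF T_Case.hyps(6) mono(4)[OF that]]])
            (use IH mono(1)[OF that] in blast)
        then show ?thesis
          using ty[OF _ T_Case.hyps(4-6)] IH by (simp add: 1(1))
      next
        case 2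
        note IH = T_Case.IH(2)[OF 2(2)] T_Case.IH(3)[OF 2(3)] T_Case.IH(4)[OF 2(4)]
        have "lin_eq (return_pmf t) (return_pmf s) B
            (\<lambda>u. Case B (msub 0 \<sigma> M) (msub 0 \<sigma> (fill C0 u)) (msub 0 \<sigma> (fill C1 u)) (msub 0 \<sigma> (fill Ce u)))"
          if "env \<sigma> (\<Gamma> ++ \<Delta>1 ++ \<Delta>2 ++ \<Delta>3 ++ \<Delta>4)" for \<sigma>
          using IH(1)[THEN conjunct2] IH(2)[THEN conjunct2] IH(3)[THEN conjunct2] mono[OF that]
          by (intro lin_eq_Case_branches good[OF T_Case.hyps(3)]) blast+
        then show ?thesis
          using ty[OF T_Case.hyps(3)] IH by (simp add: 2(1))
      qed
    qed
  next
    case (T_Rec \<Gamma>1 \<Gamma>2 \<Gamma>3 \<Delta>1 \<Delta>2 M M0 B M1 Me)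
    show ?case
    proof (cases "C = Hole \<or> C = CTerm (Rec B M M0 M1 Me)")
      case True
      then show ?thesis
        by (rule base[OF typing.T_Rec[OF T_Rec.hyps] T_Rec.prems])
    next
      case False
      note mono = map_le_Rec[OF T_Rec.hyps(1), THEN env_mono[rotated]]
      from False T_Rec.prems obtain C' where
        C: "C = CRec B C' M0 M1 Me" and M: "M = fill C' (least_inhabitant A)"
        by (cases C) auto
      note IH = T_Rec.IH(1)[OF M]
      have "lin_eq (return_pmf t) (return_pmf s) B
          (\<lambda>u. Rec B (msub 0 \<sigma> (fill C' u)) (msub 0 \<sigma> M0) (msub 0 \<sigma> M1) (msub 0 \<sigma> Me))"
        if "env \<sigma> (\<Gamma>1 ++ \<Gamma>2 ++ \<Gamma>3 ++ \<Delta>1 ++ \<Delta>2)" for \<sigma>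
        by (rule lin_eq_Rec_scrut[OF _ good[OF T_Rec.hyps(6) mono(2)[OF that]]
              good[OF T_Rec.hyps(7) mono(3)[OF that]] good[OF T_Rec.hyps(8) mono(4)[OF that]]])
          (use IH mono(1)[OF that] in blast)
      then show ?thesis
        using typing.T_Rec[OF T_Rec.hyps(1-4) _ T_Rec.hyps(6-10)] IH by (simp add: C)
    qed
  qed
qed

lemma tr_eq_context_equiv:
  assumes "closed_typing t A" "closed_typing s A" "tr_eq A (sem t) (sem s)"
  shows "context_equiv A t s"
  unfolding context_equiv_def
proof (intro allI impI)
  fix C assume "holes C \<le> 1 \<and> cx_typing C A Str"
  then have C: "closed_typing (fill C u) Str" if "closed_typing u A" for u
    using that by (simp add: cx_typing_def)
  have "closed_typing (fill C (least_inhabitant A)) Str"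
    by (rule C[OF typing_least_inhabitant]) simp
  then have "lin_eq (return_pmf t) (return_pmf s) Str (\<lambda>u. msub 0 (\<lambda>_. SConst []) (fill C u))"
    using lin_eq_fill[OF assms _ HOL.refl] env_empty by blast
  then show "pmf (sem (fill C t)) (SConst []) = pmf (sem (fill C s)) (SConst [])"
    using C assms by (simp add: lin_eq_def bind_return_pmf msub_closed[OF C])
qed

section \<open>Traces as contexts\<close>

lemma sem_App_value:
  assumes t: "good (Fun a A B) t" and v: "reducible A v"
  shows "sem (App t v) = bind_pmf (sem t) (\<lambda>f. sem (App f v))"
  using sem_App[OF t reducible_good[OF v]] sem_value[OF reducible_is_value[OF v]]
  by (simp add: bind_return_pmf)

text \<open>Good terms of function type yield only abstractions, so the failure branch of
  \<open>pass_arg\<close> receives no mass and passing an argument is the same as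
  application.\<close>

lemma pass_arg_sem:
  assumes t: "good (Fun a A B) t" and v: "reducible A v"
  shows "pass_arg (spmf_of_pmf (sem t)) v = spmf_of_pmf (sem (App t v))"
proof -
  have "(case f of Lam a A r \<Rightarrow> spmf_of_pmf (sem (subst 0 v r)) | _ \<Rightarrow> return_pmf None) =
      spmf_of_pmf (sem (App f v))" if "f \<in> set_pmf (sem t)" for f
    using good_sem_reducible[OF t that] sem_beta[OF reducible_is_value[OF v]] by auto
  then show ?thesis
    by (auto simp: pass_arg_def sem_App_value[OF t v] spmf_of_pmf_bind intro!: bind_pmf_cong)
qed

lemma trace_pr_Pass:
  "good (Fun a A B) t \<Longrightarrow> reducible A v \<Longrightarrow> trace_pr t (Pass v # S) = trace_pr (App t v) S"
  by (simp add: trace_pr_def pass_arg_sem)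

lemma trace_pr_View: "trace_pr t [View m] = pmf (sem t) (SConst m)"
  by (simp add: trace_pr_def)

text \<open>Induction on the type removes one \<open>Pass\<close> at a time. At \<open>Str\<close>,
  views compare all string constants, and every other term has probability zero on both
  sides.\<close>

lemma trace_equiv_tr_eq:
  "good A t \<Longrightarrow> good A s \<Longrightarrow> trace_equiv A t s \<Longrightarrow> tr_eq A (sem t) (sem s)"
proof (induction A arbitrary: t s)
  case Str
  have "pmf (sem t) u = pmf (sem s) u" for u
  proof (cases "\<exists>m. u = SConst m")
    case True
    then show ?thesis
      using Str(3) compatible.intros(1) by (metis trace_equiv_def trace_pr_View)
  next
    case False
    then show ?thesis
      using good_sem_reducible[OF Str(1), of u] good_sem_reducible[OF Str(2), of u]
      by (metis pmf_eq_0_set_pmf reducible.simps(1))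
  qed
  then show ?case by (simp add: pmf_eqI)
next
  case (Fun a A B)
  have "tr_eq B (bind_pmf (sem t) (\<lambda>f. sem (App f w))) (bind_pmf (sem s) (\<lambda>f. sem (App f w)))"
    if w: "reducible A w" for w
  proof -
    have "trace_equiv B (App t w) (App s w)"
      unfolding trace_equiv_def
    proof (intro allI impI)
      fix T assume "compatible B T"
      then have "compatible (Fun a A B) (Pass w # T)"
        using w by (intro compatible.intros reducible_is_value reducible_typed)
      then show "trace_pr (App t w) T = trace_pr (App s w) T"
        using Fun.prems(3) trace_pr_Pass[OF Fun.prems(1) w] trace_pr_Pass[OF Fun.prems(2) w]
        unfolding trace_equiv_def by metis
    qed
    then have "tr_eq B (sem (App t w)) (sem (App s w))"
      using Fun.prems(1,2) reducible_good[OF w] by (intro Fun.IH(2) good_App)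
    then show ?thesis
      by (simp add: sem_App_value[OF Fun.prems(1) w] sem_App_value[OF Fun.prems(2) w])
  qed
  then show ?case by simp
qed

text \<open>Context equivalence observes only the empty string; \<open>eq_test m\<close> turns any other
  \<open>View m\<close> into that observation.\<close>

primrec eq_test :: "bool list \<Rightarrow> tm" where
  "eq_test [] = Lam BBox Str (Case Str (Var 0) (SConst [True]) (SConst [True]) (SConst []))"
| "eq_test (b # m) = Lam BBox Str (Case Str (Var 0)
     (if b then SConst [True] else App (eq_test m) (Tail (Var 0)))
     (if b then App (eq_test m) (Tail (Var 0)) else SConst [True])
     (SConst [True]))"

lemma closed_typing_App:
  "closed_typing t (Fun a A B) \<Longrightarrow> closed_typing s A \<Longrightarrow> closed_typing (App t s) B"
  using T_App[of Map.empty Map.empty Map.empty t a A B s]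
  by (simp add: disjoint_ctxs_def str_ctx_def ctx_le_def)

text \<open>The argument is both scrutinised and passed on, which the rules allow since a
  \<open>Str\<close> variable may be shared. With aspect \<open>BBox\<close> the inner application
  accepts an argument that mentions this variable.\<close>

lemma typing_eq_test: "closed_typing (eq_test m) (Fun BBox Str Str)"
proof (induction m)
  let ?\<Gamma> = "bind_var BBox Str Map.empty"
  have \<Gamma>: "finite (dom ?\<Gamma>)" "str_ctx ?\<Gamma>" "ctx_le ?\<Gamma> BBox"
  proof -
    have "?\<Gamma> = [0 \<mapsto> (BBox, Str)]"
      by (auto simp: bind_var_def fun_eq_iff split: nat.splits)
    then show "finite (dom ?\<Gamma>)" "str_ctx ?\<Gamma>" "ctx_le ?\<Gamma> BBox"
      by (auto simp: str_ctx_def ctx_le_def)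
  qed
  have x: "typing ?\<Gamma> (Var 0) Str"
    using \<Gamma> by (auto intro: typing.T_Var)
  have c: "typing ?\<Gamma> (SConst n) Str" for n
    using \<Gamma> by (auto intro: typing.T_SConst)
  have lam: "closed_typing (Lam BBox Str (Case Str (Var 0) t0 t1 te)) (Fun BBox Str Str)"
    if "typing ?\<Gamma> t0 Str" "typing ?\<Gamma> t1 Str" "typing ?\<Gamma> te Str" for t0 t1 te
    using that x \<Gamma> T_Case[of ?\<Gamma> Map.empty Map.empty Map.empty Map.empty "Var 0" t0 Str t1 te]
    by (intro T_Lam) (simp add: disjoint_ctxs_def)
  {
    case Nil
    then show ?case
      using lam c by simp
  next
    case (Cons b m)
    have "typing ?\<Gamma> (App (eq_test m) (Tail (Var 0))) Str"
      using T_App[of ?\<Gamma> Map.empty Map.empty "eq_test m" BBox Str Str "Tail (Var 0)"]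
        typing_weaken[OF Cons.IH, of ?\<Gamma>] \<Gamma> T_Tail[OF x]
      by (simp add: disjoint_ctxs_def)
    then show ?case
      using lam c by (cases b) simp_all
  }
qed

lemma sem_Case_SConst:
  "good A t0 \<Longrightarrow> good A t1 \<Longrightarrow> good A te \<Longrightarrow>
    sem (Case B (SConst n) t0 t1 te) = sem (case_cont t0 t1 te n)"
  using sem_eqI[OF eval_Case[of "SConst n", OF _ good_case_cont]]
  by (simp add: bind_return_pmf)

lemma sem_eq_test: "sem (App (eq_test m) (SConst n)) = return_pmf (SConst (if n = m then [] else [True]))"
proof (induction m arbitrary: n)
  case Nil
  then show ?case
    by (cases n) (auto simp: sem_beta is_value.intros sem_Case_SConst[of Str])
next
  case (Cons b m)
  have g: "good (Fun BBox Str Str) (eq_test m)" "good Str (Tail (SConst n))"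
    using closed_good[OF typing_eq_test] good_Tail by auto
  have "sem (Tail (SConst n)) = return_pmf (SConst (tl n))"
    using sem_eqI[OF eval_Tail[of "SConst n"]] by simp
  then have "sem (App (eq_test m) (Tail (SConst n))) = sem (App (eq_test m) (SConst (tl n)))"
    using sem_App[OF g] sem_App[OF g(1) good_SConst[of "tl n"]] by simp
  then show ?case
    using good_App[OF g]
    by (cases n; cases b)
      (auto simp: Cons.IH sem_beta is_value.intros sem_Case_SConst[of Str]
        subst_closed[OF typing_eq_test])
qed

lemma pmf_eq_test:
  assumes "good Str t"
  shows "pmf (sem (App (eq_test m) t)) (SConst []) = pmf (sem t) (SConst m)"
proof -
  define D where "D = map_pmf str_of (sem t)"
  have t: "sem t = map_pmf SConst D"
    using sem_eqI[OF good_Str_eval[OF assms]] by (simp add: D_def)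
  have "sem (App (eq_test m) t) =
      bind_pmf (sem (eq_test m)) (\<lambda>f. bind_pmf (sem t) (\<lambda>w. sem (App f w)))"
    by (rule sem_App[OF closed_good[OF typing_eq_test] assms])
  also have "sem (eq_test m) = return_pmf (eq_test m)"
    by (rule sem_value) (cases m, auto intro: is_value.intros)
  finally have "sem (App (eq_test m) t) = map_pmf (\<lambda>n. SConst (if n = m then [] else [True])) D"
    by (simp add: bind_return_pmf t sem_eq_test map_pmf_def bind_assoc_pmf)
  moreover have "(\<lambda>n. SConst (if n = m then [] else [True])) -` {SConst []} = {m}"
    by (auto split: if_splits)
  moreover have "SConst -` {SConst m} = {m}"
    by auto
  ultimately show ?thesis
    by (simp add: t pmf_map measure_pmf_single)
qed

text \<open>The second argument accumulates the context built so far, so that successive passes nest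
  to the left as in a curried application and the test ends up outermost.\<close>

fun trace_cx :: "act list \<Rightarrow> cx \<Rightarrow> cx" where
  "trace_cx [View m] C = CAppR (eq_test m) C"
| "trace_cx (Pass v # S) C = trace_cx S (CAppL C v)"
| "trace_cx _ C = C"

lemma trace_cx:
  "compatible A T \<Longrightarrow> holes (trace_cx T C) = holes C \<and>
    (closed_typing (fill C t) A \<longrightarrow> closed_typing (fill (trace_cx T C) t) Str \<and>
      pmf (sem (fill (trace_cx T C) t)) (SConst []) = trace_pr (fill C t) T)"
proof (induction arbitrary: C rule: compatible.induct)
  case (1 m)
  then show ?case
    by (auto simp: trace_pr_View pmf_eq_test closed_good intro: closed_typing_App typing_eq_test)
next
  case (2 v A B S a)
  then show ?case
    using closed_typing_App[of "fill C t" a A B v] trace_pr_Pass[of a A B "fill C t" v S] 2(4)[of "CAppL C v"]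
    by (auto simp: closed_good closed_value_reducible)
qed

lemma context_equiv_trace_equiv:
  assumes "closed_typing t A" "closed_typing s A" "context_equiv A t s"
  shows "trace_equiv A t s"
  unfolding trace_equiv_def
proof (intro allI impI)
  fix T assume T: "compatible A T"
  have "cx_typing (trace_cx T Hole) A Str"
    using trace_cx[OF T, of Hole] by (simp add: cx_typing_def)
  then have "pmf (sem (fill (trace_cx T Hole) t)) (SConst []) =
      pmf (sem (fill (trace_cx T Hole) s)) (SConst [])"
    using assms(3) trace_cx[OF T, of Hole] by (simp add: context_equiv_def)
  then show "trace_pr t T = trace_pr s T"
    using trace_cx[OF T, of Hole t] trace_cx[OF T, of Hole s] assms(1,2) by simp
qed

theorem mainTheorem4:
  fixes A :: ty and t s :: tm
  assumes "closed_typing t A" and "closed_typing s A"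
  shows "context_equiv A t s \<longleftrightarrow> trace_equiv A t s"
  using assms context_equiv_trace_equiv tr_eq_context_equiv trace_equiv_tr_eq closed_good by blast

end
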